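(* A space curve $\varphi(s)$ in $E^3$, considered with respect to its modified orthogonal frame, is a Mannheim curve if and only if its curvature $\kappa_\varphi$ and torsion $\tau_\varphi$ satisfy $$\kappa_\varphi=c\left(\kappa_\varphi^2+\tau_\varphi^2\right),$$ where $c$ is a nonzero constant.
   Context: $E^3$ is Euclidean 3-space with its standard inner product. Curves are analytic, parametrized by arc length, and the curvature $\kappa$ is not identically zero (its zeros are discrete). The modified orthogonal frame of such a curve $\varphi$ is $T=\frac{d\varphi}{ds}$, $N=\frac{dT}{ds}$, $B=T\times N$. At points with $\kappa\neq 0$, $T=t$, $N=\kappa n$, $B=\kappa b$, where $\{t,n,b\}$ is the Frenet frame, and $$T'=N,\qquad N'=-\kappa^2T+\frac{\kappa'}{\kappa}N+\tau B,\qquad B'=-\tau N+\frac{\kappa'}{\kappa}B,$$ where $\tau=\det(\varphi',\varphi'',\varphi''')/\kappa^2$ is the torsion (zeros of $\kappa$ are removable singularities of $\tau$). Subscripts $\varphi,\psi$ indicate the curve to which a quantity belongs. Mannheim pair: let $\varphi$ and $\psi$ be two space curves in $E^3$ with a correspondence between their points such that, at corresponding points, the principal normal line of $\varphi$ coincides with the binormal line of $\psi$. Then $\varphi$ is called a Mannheim curve, $\psi$ a Mannheim partner curve of $\varphi$, and $\{\varphi,\psi\}$ a Mannheim pair.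
   Formalization: The "if" direction additionally assumes that the curvature is not constant and that the torsion is nonzero wherever the curvature is; without this it fails (circles, circular helices, curves whose only possible partner has a cusp). The "only if" direction is unchanged. *)

theory Defs
  imports "HOL-Analysis.Analysis"
begin

definition real_analytic_on :: "(real \<Rightarrow> 'a::real_normed_vector) \<Rightarrow> real set \<Rightarrow> bool" where
  "real_analytic_on f S \<longleftrightarrow>
     (\<forall>x\<in>S. \<exists>a. \<exists>r>0. \<forall>y. \<bar>y - x\<bar> < r \<longrightarrow> (\<lambda>n. (y - x) ^ n *\<^sub>R a n) sums f y)"

definition frame_T :: "(real \<Rightarrow> real^3) \<Rightarrow> real \<Rightarrow> real^3" where
  "frame_T \<phi> s = vector_derivative \<phi> (at s)"

definition frame_N :: "(real \<Rightarrow> real^3) \<Rightarrow> real \<Rightarrow> real^3" where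
  "frame_N \<phi> s = vector_derivative (frame_T \<phi>) (at s)"

definition frame_B :: "(real \<Rightarrow> real^3) \<Rightarrow> real \<Rightarrow> real^3" where
  "frame_B \<phi> s = cross3 (frame_T \<phi> s) (frame_N \<phi> s)"

definition curvature :: "(real \<Rightarrow> real^3) \<Rightarrow> real \<Rightarrow> real" where
  "curvature \<phi> s = norm (frame_N \<phi> s)"

definition torsion_quotient :: "(real \<Rightarrow> real^3) \<Rightarrow> real \<Rightarrow> real" where
  "torsion_quotient \<phi> s =
     det (vector [frame_T \<phi> s, frame_N \<phi> s, vector_derivative (frame_N \<phi>) (at s)] :: real^3^3)
       / (curvature \<phi> s)\<^sup>2"

text \<open>Zeros of the curvature are removable singularities of the torsion; there the torsion is
  the value of the continuous extension, not the value of the quotient (which is 0 in HOL).\<close>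

definition torsion :: "(real \<Rightarrow> real^3) \<Rightarrow> real \<Rightarrow> real" where
  "torsion \<phi> s =
     (if curvature \<phi> s \<noteq> 0 then torsion_quotient \<phi> s else Lim (at s) (torsion_quotient \<phi>))"

definition space_curve :: "real set \<Rightarrow> (real \<Rightarrow> real^3) \<Rightarrow> bool" where
  "space_curve I \<phi> \<longleftrightarrow>
     open I \<and> is_interval I \<and> real_analytic_on \<phi> I \<and>
     (\<forall>s\<in>I. norm (frame_T \<phi> s) = 1) \<and> (\<exists>s\<in>I. curvature \<phi> s \<noteq> 0)"

text \<open>Where the curvature is nonzero, \<open>frame_N\<close> and \<open>frame_B\<close> are nonzero multiples of the
  Frenet principal normal and binormal, so the following two sets are the usual lines. Where the
  curvature vanishes they degenerate to a point.\<close>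

definition principal_normal_line :: "(real \<Rightarrow> real^3) \<Rightarrow> real \<Rightarrow> (real^3) set" where
  "principal_normal_line \<phi> s = range (\<lambda>r. \<phi> s + r *\<^sub>R frame_N \<phi> s)"

definition binormal_line :: "(real \<Rightarrow> real^3) \<Rightarrow> real \<Rightarrow> (real^3) set" where
  "binormal_line \<psi> s = range (\<lambda>r. \<psi> s + r *\<^sub>R frame_B \<psi> s)"

text \<open>Each curve is parametrized by its own arc length, and \<open>h\<close> is the correspondence of
  parameters: the point \<open>\<phi> s\<close> corresponds to \<open>\<psi> (h s)\<close>. The lines are compared where both are
  defined, that is, away from the isolated zeros of the two curvatures.\<close>

definition mannheim_pair ::
  "real set \<Rightarrow> (real \<Rightarrow> real^3) \<Rightarrow> real set \<Rightarrow> (real \<Rightarrow> real^3) \<Rightarrow> bool" where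
  "mannheim_pair I \<phi> J \<psi> \<longleftrightarrow>
     space_curve I \<phi> \<and> space_curve J \<psi> \<and>
     (\<exists>h. bij_betw h I J \<and> h differentiable_on I \<and>
        (\<forall>s\<in>I. curvature \<phi> s \<noteq> 0 \<longrightarrow> curvature \<psi> (h s) \<noteq> 0 \<longrightarrow>
           principal_normal_line \<phi> s = binormal_line \<psi> (h s)))"

definition mannheim_curve :: "real set \<Rightarrow> (real \<Rightarrow> real^3) \<Rightarrow> bool" where
  "mannheim_curve I \<phi> \<longleftrightarrow> (\<exists>J \<psi>. mannheim_pair I \<phi> J \<psi>)"

text \<open>Given the curvature relation with constant \<open>c\<close>, the only possible partner is
  \<open>\<phi> + c n\<close>. It is a point for circles, a straight line (the axis) for circular helices, and it
  is singular where the torsion vanishes but the curvature does not. The next condition excludes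
  exactly these cases.\<close>

definition nondegenerate_curve :: "real set \<Rightarrow> (real \<Rightarrow> real^3) \<Rightarrow> bool" where
  "nondegenerate_curve I \<phi> \<longleftrightarrow>
     \<not> curvature \<phi> constant_on I \<and>
     (\<forall>s\<in>I. curvature \<phi> s \<noteq> 0 \<longrightarrow> torsion \<phi> s \<noteq> 0)"

end

theory Submission
  imports Defs "HOL-Complex_Analysis.Complex_Analysis"
begin

text \<open>
  Write \<open>t, n, b\<close> for the Frenet frame of \<open>\<phi>\<close>. Away from the zeros of the curvature,
  \<open>n' = - \<kappa> t + \<tau> b\<close>, so \<open>t \<bullet> n' = - \<kappa>\<close> and \<open>n' \<bullet> n' = \<kappa>\<^sup>2 + \<tau>\<^sup>2\<close>.

  \<^bold>\<open>Necessity.\<close> A partner \<open>\<psi>\<close> meets the normal line of \<open>\<phi>\<close>, so \<open>\<psi> \<circ> h = \<phi> + \<lambda> n\<close>, and its binormal is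
  parallel to \<open>n\<close>, so both its tangent and its principal normal are orthogonal to \<open>n\<close>. Orthogonality of
  the tangent forces \<open>\<lambda>' = 0\<close>. Differentiating it once more, and using orthogonality of the normal, gives
  \<open>T\<^sub>\<psi> \<bullet> n' = 0\<close>. As \<open>h' T\<^sub>\<psi> = t + \<lambda> n'\<close>, pairing with \<open>n'\<close> yields \<open>\<kappa> = \<lambda> (\<kappa>\<^sup>2 + \<tau>\<^sup>2)\<close>
  (\<open>mannheim_relation_on_interval\<close>). This works on one small interval where both curvatures are nonzero.
  The curvature, a norm, need not be analytic at its zeros, but squaring and clearing
  denominators turns the relation into the vanishing of a polynomial in \<open>\<kappa>\<^sup>2\<close> and
  \<open>det (\<phi>', \<phi>'', \<phi>''')\<close>, which are analytic; the identity theorem carries it to the whole interval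
  (\<open>curvature_relation_global\<close>). At a zero of \<open>\<kappa>\<close> the relation makes the torsion tend to \<open>0\<close>.

  \<^bold>\<open>Sufficiency.\<close> The partner is \<open>\<phi> + c n\<close>, reparametrized by arc length. The obstacle is that
  \<open>n = \<phi>'' / \<kappa>\<close> could jump to its negative at a zero of \<open>\<kappa>\<close>. The relation excludes this: it
  bounds the torsion near the zero, so the torsion has a removable singularity and
  \<open>\<kappa> = c (\<kappa>\<^sup>2 + \<tau>\<^sup>2)\<close> is itself analytic; then \<open>\<phi>'' / \<kappa>\<close> is a bounded quotient of
  analytic functions and extends analytically (\<open>normal_ext\<close>). Now
  \<open>(\<phi> + c n)' = (1 - c \<kappa>) t + c \<tau> b\<close>, whose squared length is \<open>1 - c \<kappa>\<close> by the relation, positive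
  by nondegeneracy. With \<open>v = sqrt (1 - c \<kappa>)\<close> and \<open>w = c \<tau> / v\<close> the unit tangent is
  \<open>v t + w b\<close>; its derivative has no \<open>n\<close> component because \<open>v \<kappa> = w \<tau>\<close>, so the binormal of the
  new curve is a multiple of \<open>n\<close> (\<open>relation_imp_mannheim_curve\<close>).

  Analyticity of real functions is handled by holomorphic extension. This makes quotients,
  square roots, inverse functions and removable singularities consequences of complex analysis.
\<close>

section \<open>Real analytic functions as restrictions of holomorphic functions\<close>

text \<open>Equivalent to convergence of the Taylor series (\<open>real_analytic_at_power_series\<close> and
  \<open>real_analytic_at_imp_power_series\<close> below), but preserved by compositions and quotients
  for the reasons known from complex analysis.\<close>
definition real_analytic_at :: "(real \<Rightarrow> real) \<Rightarrow> real \<Rightarrow> bool" where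
  "real_analytic_at f x \<longleftrightarrow> (\<exists>F. F analytic_on {complex_of_real x} \<and>
     (\<forall>\<^sub>F y in nhds x. F (complex_of_real y) = complex_of_real (f y)))"

lemma eventually_nhds_of_real:
  assumes "\<forall>\<^sub>F z in nhds (complex_of_real x). P z"
  shows "\<forall>\<^sub>F y in nhds x. P (complex_of_real y)"
proof -
  have "((\<lambda>y. complex_of_real y) \<longlongrightarrow> complex_of_real x) (nhds x)"
    by (intro tendsto_of_real) (simp add: filterlim_ident)
  then show ?thesis using assms by (simp add: filterlim_iff)
qed

lemma eventually_at_of_real:
  assumes "\<forall>\<^sub>F z in at (complex_of_real x). P z"
  shows "\<forall>\<^sub>F y in at x. P (complex_of_real y)"
  using eventually_nhds_of_real[of "\<lambda>z. z \<noteq> complex_of_real x \<longrightarrow> P z" x] assms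
  by (simp add: eventually_at_filter)

lemma isCont_tendsto_nhds: "isCont f x \<Longrightarrow> (f \<longlongrightarrow> f x) (nhds x)"
  unfolding isCont_def using tendsto_at_iff_tendsto_nhds[of f x] by simp

lemma real_analytic_at_const: "real_analytic_at (\<lambda>y. c) x"
  unfolding real_analytic_at_def by (rule exI[of _ "\<lambda>z. of_real c"]) auto

lemma real_analytic_at_add: "real_analytic_at f x \<Longrightarrow> real_analytic_at g x \<Longrightarrow> real_analytic_at (\<lambda>y. f y + g y) x"
  unfolding real_analytic_at_def
  by (elim exE conjE, rule_tac x="\<lambda>z. F z + Fa z" in exI)
     (auto intro!: analytic_on_add elim: eventually_elim2)

lemma real_analytic_at_mult: "real_analytic_at f x \<Longrightarrow> real_analytic_at g x \<Longrightarrow> real_analytic_at (\<lambda>y. f y * g y) x"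
  unfolding real_analytic_at_def
  by (elim exE conjE, rule_tac x="\<lambda>z. F z * Fa z" in exI)
     (auto intro!: analytic_on_mult elim: eventually_elim2)

lemma real_analytic_at_diff: "real_analytic_at f x \<Longrightarrow> real_analytic_at g x \<Longrightarrow> real_analytic_at (\<lambda>y. f y - g y) x"
  using real_analytic_at_add[of f x "\<lambda>y. - 1 * g y"] real_analytic_at_mult[OF real_analytic_at_const[of "-1" x], of g] by simp

lemma real_analytic_at_power: "real_analytic_at f x \<Longrightarrow> real_analytic_at (\<lambda>y. f y ^ n) x"
  by (induction n) (auto intro: real_analytic_at_const real_analytic_at_mult)

lemma real_analytic_at_value:
  assumes "\<forall>\<^sub>F y in nhds x. F (complex_of_real y) = complex_of_real (f y)"
  shows "F (complex_of_real x) = complex_of_real (f x)"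
  using eventually_nhds_x_imp_x[OF assms] .

lemma real_analytic_at_divide:
  assumes "real_analytic_at f x" "real_analytic_at g x" "g x \<noteq> 0" shows "real_analytic_at (\<lambda>y. f y / g y) x"
proof -
  from assms obtain F G where F: "F analytic_on {complex_of_real x}"
     "\<forall>\<^sub>F y in nhds x. F (complex_of_real y) = complex_of_real (f y)"
    and G: "G analytic_on {complex_of_real x}"
     "\<forall>\<^sub>F y in nhds x. G (complex_of_real y) = complex_of_real (g y)"
    unfolding real_analytic_at_def by blast
  have "(\<lambda>z. F z / G z) analytic_on {complex_of_real x}"
    using F(1) G(1) real_analytic_at_value[OF G(2)] assms(3) by (intro analytic_on_divide) auto
  moreover have "\<forall>\<^sub>F y in nhds x. F (complex_of_real y) / G (complex_of_real y) = complex_of_real (f y / g y)"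
    using F(2) G(2) by eventually_elim simp
  ultimately show ?thesis unfolding real_analytic_at_def by blast
qed

text \<open>The principal branch of the complex square root is holomorphic off the nonpositive reals,
  and on positive reals it is the real square root.\<close>
lemma real_analytic_at_sqrt:
  assumes "real_analytic_at f x" "f x > 0" shows "real_analytic_at (\<lambda>y. sqrt (f y)) x"
proof -
  from assms obtain F where F: "F analytic_on {complex_of_real x}"
     "\<forall>\<^sub>F y in nhds x. F (complex_of_real y) = complex_of_real (f y)"
    unfolding real_analytic_at_def by blast
  have Fx: "F (complex_of_real x) = complex_of_real (f x)" by (rule real_analytic_at_value[OF F(2)])
  have "(\<lambda>z. csqrt (F z)) analytic_on {complex_of_real x}"
    using F(1) Fx assms(2) by (intro analytic_on_csqrt') (auto simp: complex_nonpos_Reals_iff)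
  moreover have "isCont (\<lambda>y. F (complex_of_real y)) x"
    by (rule isCont_o2[where g=F]) (auto intro!: analytic_at_imp_isCont F continuous_intros)
  then have "((\<lambda>y. Re (F (complex_of_real y))) \<longlongrightarrow> Re (F (complex_of_real x))) (nhds x)"
    by (intro tendsto_Re) (rule isCont_tendsto_nhds)
  then have "\<forall>\<^sub>F y in nhds x. Re (F (complex_of_real y)) > 0"
    by (rule order_tendstoD) (use assms(2) Fx in auto)
  then have "\<forall>\<^sub>F y in nhds x. csqrt (F (complex_of_real y)) = complex_of_real (sqrt (f y))"
    using F(2) by eventually_elim (simp add: csqrt_of_real_nonneg)
  ultimately show ?thesis unfolding real_analytic_at_def by blast
qed

lemma real_analytic_at_cong:
  assumes "real_analytic_at f x" "\<forall>\<^sub>F y in nhds x. f y = g y" shows "real_analytic_at g x"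
proof -
  from assms obtain F where F: "F analytic_on {complex_of_real x}"
     "\<forall>\<^sub>F y in nhds x. F (complex_of_real y) = complex_of_real (f y)"
    unfolding real_analytic_at_def by blast
  have "\<forall>\<^sub>F y in nhds x. F (complex_of_real y) = complex_of_real (g y)"
    using F(2) assms(2) by eventually_elim simp
  then show ?thesis using F(1) unfolding real_analytic_at_def by blast
qed

text \<open>A holomorphic function that is real on the real axis has a real derivative there: the imaginary
  part vanishes along the axis, hence so does its derivative.\<close>
lemma holomorphic_real_restriction_deriv:
  assumes "\<forall>\<^sub>F u in nhds y. F (complex_of_real u) = complex_of_real (f u)"
    and "(F has_field_derivative d) (at (complex_of_real y))"
  shows "(f has_real_derivative Re d) (at y)" "d = complex_of_real (Re d)"
proof -
  have *: "((\<lambda>u. F (complex_of_real u)) has_vector_derivative d) (at y)"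
    using field_vector_diff_chain_at[of complex_of_real 1 y F d] assms(2)
    by (auto simp: o_def intro!: has_vector_derivative_real_field derivative_eq_intros)
  have **: "((\<lambda>u. complex_of_real (f u)) has_vector_derivative d) (at y)"
    using has_vector_derivative_cong_ev[where S = UNIV and x = y and f' = d and
        f = "\<lambda>u. F (complex_of_real u)" and g = "\<lambda>u. complex_of_real (f u)"] assms(1) * 
      real_analytic_at_value[OF assms(1)] by auto
  have re: "((\<lambda>u. Re (complex_of_real (f u))) has_vector_derivative Re d) (at y)"
    using bounded_linear.has_vector_derivative[OF bounded_linear_Re **] .
  then show "(f has_real_derivative Re d) (at y)"
    by (simp add: has_real_derivative_iff_has_vector_derivative)
  have "((\<lambda>u. Im (complex_of_real (f u))) has_vector_derivative Im d) (at y)"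
    using bounded_linear.has_vector_derivative[OF bounded_linear_Im **] .
  then have "Im d = 0"
    using vector_derivative_at[of "\<lambda>u. 0" "Im d" y] by simp
  then show "d = complex_of_real (Re d)" by (simp add: complex_eq_iff)
qed

lemma real_analytic_at_deriv:
  assumes "real_analytic_at f x"
  shows "\<forall>\<^sub>F y in nhds x. (f has_real_derivative deriv f y) (at y)" "real_analytic_at (deriv f) x"
proof -
  from assms obtain F where F: "F analytic_on {complex_of_real x}"
     "\<forall>\<^sub>F y in nhds x. F (complex_of_real y) = complex_of_real (f y)"
    unfolding real_analytic_at_def by blast
  obtain A where A: "open A" "complex_of_real x \<in> A" "F holomorphic_on A"
    using F(1) by (auto simp: analytic_at)
  have "\<forall>\<^sub>F z in nhds (complex_of_real x). (F has_field_derivative deriv F z) (at z)"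
    unfolding eventually_nhds using A holomorphic_derivI[of F A] by (intro exI[of _ A]) auto
  then have d: "\<forall>\<^sub>F y in nhds x. (F has_field_derivative deriv F (of_real y)) (at (of_real y))" 
    by (rule eventually_nhds_of_real)
  have e: "\<forall>\<^sub>F y in nhds x. \<forall>\<^sub>F u in nhds y. F (complex_of_real u) = complex_of_real (f u)"
    using F(2) by (simp add: eventually_eventually)
  have both: "\<forall>\<^sub>F y in nhds x. (f has_real_derivative deriv f y) (at y) \<and> 
     deriv F (complex_of_real y) = complex_of_real (deriv f y)"
    using d e
  proof eventually_elim
    case (elim y)
    from holomorphic_real_restriction_deriv[OF elim(2,1)] show ?case by (metis DERIV_imp_deriv)
  qed
  show "\<forall>\<^sub>F y in nhds x. (f has_real_derivative deriv f y) (at y)"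
    using both by eventually_elim simp
  show "real_analytic_at (deriv f) x"
    unfolding real_analytic_at_def using both by (intro exI[of _ "deriv F"]) (auto intro: analytic_deriv F elim: eventually_mono)
qed

lemma real_analytic_at_isCont: "real_analytic_at f x \<Longrightarrow> isCont f x"
  using eventually_nhds_x_imp_x[OF real_analytic_at_deriv(1)] DERIV_isCont by blast

lemma real_analytic_at_compose:
  assumes "real_analytic_at f x" "real_analytic_at g (f x)" shows "real_analytic_at (\<lambda>y. g (f y)) x"
proof -
  from assms obtain F G where F: "F analytic_on {complex_of_real x}"
     "\<forall>\<^sub>F y in nhds x. F (complex_of_real y) = complex_of_real (f y)"
    and G: "G analytic_on {complex_of_real (f x)}"
     "\<forall>\<^sub>F y in nhds (f x). G (complex_of_real y) = complex_of_real (g y)"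
    unfolding real_analytic_at_def by blast
  have "(G \<circ> F) analytic_on {complex_of_real x}"
    using F(1) G(1) real_analytic_at_value[OF F(2)] by (intro analytic_on_compose) auto
  moreover have "filterlim f (nhds (f x)) (nhds x)"
    using real_analytic_at_isCont[OF assms(1)] by (rule isCont_tendsto_nhds)
  then have "\<forall>\<^sub>F y in nhds x. G (complex_of_real (f y)) = complex_of_real (g (f y))"
    by (rule eventually_compose_filterlim[OF G(2)])
  then have "\<forall>\<^sub>F y in nhds x. (G \<circ> F) (complex_of_real y) = complex_of_real (g (f y))"
    using F(2) by eventually_elim simp
  ultimately show ?thesis unfolding real_analytic_at_def by blast
qed

text \<open>If the holomorphic extension vanishes on a disc, so does the function on an interval;
  otherwise the zeros of the extension are isolated.\<close>
lemma real_analytic_at_isolated_zeros: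
  assumes "real_analytic_at f x"
  shows "(\<forall>\<^sub>F y in nhds x. f y = 0) \<or> (\<forall>\<^sub>F y in at x. f y \<noteq> 0)"
proof -
  from assms obtain F where F: "F analytic_on {complex_of_real x}"
     "\<forall>\<^sub>F y in nhds x. F (complex_of_real y) = complex_of_real (f y)"
    unfolding real_analytic_at_def by blast
  obtain r where r: "r > 0" "F holomorphic_on ball (complex_of_real x) r"
    using F(1) by (auto simp: analytic_at_ball)
  show ?thesis
  proof (cases "\<forall>z\<in>ball (complex_of_real x) r. F z = 0")
    case True
    then have "\<forall>\<^sub>F z in nhds (complex_of_real x). F z = 0"
      unfolding eventually_nhds using r(1) by (intro exI[of _ "ball (complex_of_real x) r"]) auto
    from eventually_nhds_of_real[OF this] F(2) have "\<forall>\<^sub>F y in nhds x. f y = 0"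
      by eventually_elim simp
    then show ?thesis ..
  next
    case False
    then obtain b where "b \<in> ball (complex_of_real x) r" "F b \<noteq> 0" by blast
    then have "\<forall>\<^sub>F z in at (complex_of_real x). F z \<noteq> 0"
      using non_zero_neighbour_alt[OF r(2) _ _ _ \<open>b \<in> _\<close>, of "complex_of_real x"] r(1)
      by (auto elim: eventually_mono)
    from eventually_at_of_real[OF this] have "\<forall>\<^sub>F y in at x. F (complex_of_real y) \<noteq> 0" .
    moreover have "\<forall>\<^sub>F y in at x. F (complex_of_real y) = complex_of_real (f y)"
      using F(2) by (simp add: eventually_at_filter eventually_mono)
    ultimately have "\<forall>\<^sub>F y in at x. f y \<noteq> 0" by eventually_elim auto
    then show ?thesis ..
  qed
qed

text \<open>The complex quotient is meromorphic at the point. A pole would make its absolute value tend to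
  infinity from every direction, in particular along the real axis, where it stays bounded; so
  the singularity is removable. A bound on the real axis is thus enough, although Riemann's
  theorem asks for one in a complex neighbourhood.\<close>
lemma real_analytic_at_removable_quotient:
  assumes "real_analytic_at f x" "real_analytic_at g x" and nz: "\<forall>\<^sub>F y in at x. g y \<noteq> 0"
    and bd: "\<forall>\<^sub>F y in at x. \<bar>f y / g y\<bar> \<le> M"
  shows "\<exists>q. real_analytic_at q x \<and> (\<forall>\<^sub>F y in at x. q y = f y / g y)"
proof -
  from assms obtain F G where F: "F analytic_on {complex_of_real x}"
     "\<forall>\<^sub>F y in nhds x. F (complex_of_real y) = complex_of_real (f y)"
    and G: "G analytic_on {complex_of_real x}"
     "\<forall>\<^sub>F y in nhds x. G (complex_of_real y) = complex_of_real (g y)"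
    unfolding real_analytic_at_def by blast
  define Q where "Q = (\<lambda>z. F z / G z)"
  have Qeq: "\<forall>\<^sub>F y in at x. Q (complex_of_real y) = complex_of_real (f y / g y)"
    using F(2) G(2) unfolding eventually_at_filter Q_def by eventually_elim simp
  have "Q meromorphic_on {complex_of_real x}"
    unfolding Q_def by (intro meromorphic_on_divide analytic_on_imp_meromorphic_on F G)
  then have iso: "isolated_singularity_at Q (complex_of_real x)" and ne: "not_essential Q (complex_of_real x)"
    by (auto simp: meromorphic_at_iff)
  have "\<not> is_pole Q (complex_of_real x)"
  proof
    assume "is_pole Q (complex_of_real x)"
    then have "\<forall>\<^sub>F z in at (complex_of_real x). cmod (Q z) \<ge> M + 1"
      by (simp add: is_pole_def filterlim_at_infinity_imp_norm_at_top filterlim_at_top[THEN iffD1])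
    from eventually_at_of_real[OF this] Qeq bd have "\<forall>\<^sub>F y in at x. False"
    proof eventually_elim
      case (elim y)
      have "cmod (Q (complex_of_real y)) = \<bar>f y / g y\<bar>" by (metis elim(2) norm_of_real)
      with elim show ?case by linarith
    qed
    then show False by simp
  qed
  then obtain c where c: "Q \<midarrow>complex_of_real x\<rightarrow> c" using ne by (auto simp: not_essential_def)
  have an: "remove_sings Q analytic_on {complex_of_real x}"
    by (rule remove_sings_analytic_at[OF iso c])
  define q where "q y = (if y = x then Re c else f y / g y)" for y
  have "\<forall>\<^sub>F y in at x. remove_sings Q (complex_of_real y) = Q (complex_of_real y)"
    by (rule eventually_at_of_real[OF eventually_remove_sings_eq_at[OF iso]])
  then have R: "\<forall>\<^sub>F y in at x. remove_sings Q (complex_of_real y) = complex_of_real (q y)"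
    using Qeq unfolding eventually_at_filter by eventually_elim (simp add: q_def)
  have "filterlim complex_of_real (at (complex_of_real x)) (at x)"
    by (intro filterlim_atI tendsto_intros) (auto simp: eventually_at_filter)
  then have "((\<lambda>y. Q (complex_of_real y)) \<longlongrightarrow> c) (at x)"
    using c filterlim_compose by blast
  then have lim: "((\<lambda>y. complex_of_real (f y / g y)) \<longlongrightarrow> c) (at x)"
    using Qeq by (rule Lim_transform_eventually)
  have "((\<lambda>y. Im (complex_of_real (f y / g y))) \<longlongrightarrow> Im c) (at x)"
    by (rule tendsto_Im[OF lim])
  then have "Im c = 0" by (simp add: tendsto_const_iff)
  then have "remove_sings Q (complex_of_real x) = complex_of_real (q x)"
    using remove_sings_eqI[OF c] by (simp add: q_def complex_eq_iff)
  then have "\<forall>\<^sub>F y in nhds x. remove_sings Q (complex_of_real y) = complex_of_real (q y)"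
    using R unfolding eventually_at_filter by (auto elim!: eventually_mono)
  then have "real_analytic_at q x" using an unfolding real_analytic_at_def by blast
  moreover have "\<forall>\<^sub>F y in at x. q y = f y / g y"
    by (simp add: eventually_at_filter q_def)
  ultimately show ?thesis by blast
qed

text \<open>The points near which the function vanishes identically, and the points around which it is
  nonzero, form two disjoint open sets that cover the interval, which is connected.\<close>
lemma real_analytic_at_identity_interval:
  assumes "is_interval I" and "\<And>x. x \<in> I \<Longrightarrow> real_analytic_at f x"
    and "a \<in> I" "\<forall>\<^sub>F y in nhds a. f y = 0" "x \<in> I"
  shows "f x = 0"
proof -
  define Z where "Z = {x. \<forall>\<^sub>F y in nhds x. f y = 0}"
  define W where "W = {x. \<forall>\<^sub>F y in at x. f y \<noteq> 0}"
  have "open Z"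
  proof (subst open_subopen, intro ballI)
    fix x assume "x \<in> Z"
    then have "\<exists>S. open S \<and> x \<in> S \<and> (\<forall>y\<in>S. f y = 0)"
      by (simp add: Z_def eventually_nhds)
    then obtain S where S: "open S" "x \<in> S" "\<forall>y\<in>S. f y = 0" by blast
    then have "S \<subseteq> Z" unfolding Z_def eventually_nhds by blast
    with S show "\<exists>T. open T \<and> x \<in> T \<and> T \<subseteq> Z" by blast
  qed
  have "open W"
  proof (subst open_subopen, intro ballI)
    fix x assume "x \<in> W"
    then have "\<exists>S. open S \<and> x \<in> S \<and> (\<forall>y\<in>S. y \<noteq> x \<longrightarrow> f y \<noteq> 0)"
      by (simp add: W_def eventually_at_topological)
    then obtain S where S: "open S" "x \<in> S" "\<forall>y\<in>S. y \<noteq> x \<longrightarrow> f y \<noteq> 0" by blast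
    have "S \<subseteq> W"
    proof
      fix y assume "y \<in> S"
      show "y \<in> W"
      proof (cases "y = x")
        case False
        have "open (S - {x})" using S by auto
        moreover have "y \<in> S - {x}" using False \<open>y \<in> S\<close> by auto
        ultimately show ?thesis unfolding W_def eventually_at_topological using S(3) by blast
      qed (use \<open>x \<in> W\<close> in auto)
    qed
    with S show "\<exists>T. open T \<and> x \<in> T \<and> T \<subseteq> W" by blast
  qed
  have disj: "Z \<inter> W = {}"
  proof (rule ccontr)
    assume "Z \<inter> W \<noteq> {}"
    then obtain x where "\<forall>\<^sub>F y in nhds x. f y = 0" "\<forall>\<^sub>F y in at x. f y \<noteq> 0"
      by (auto simp: Z_def W_def)
    then have "\<forall>\<^sub>F y in at x. False" unfolding eventually_at_filter by eventually_elim auto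
    then show False by simp
  qed
  have "I \<subseteq> Z \<union> W"
    using real_analytic_at_isolated_zeros assms(2) by (auto simp: Z_def W_def)
  moreover have "connected I" using assms(1) by (simp add: is_interval_connected_1)
  moreover have "Z \<inter> I \<noteq> {}" using assms(3,4) by (auto simp: Z_def)
  ultimately have "W \<inter> I = {}"
    using connectedD[of I Z W] \<open>open Z\<close> \<open>open W\<close> disj by blast
  then have "x \<in> Z" using \<open>I \<subseteq> Z \<union> W\<close> assms(5) by blast
  then show ?thesis unfolding Z_def by (auto dest: eventually_nhds_x_imp_x)
qed

lemma real_analytic_at_isolated_zeros_interval:
  assumes "is_interval I" "\<And>x. x \<in> I \<Longrightarrow> real_analytic_at f x" "a \<in> I" "f a \<noteq> 0" "x \<in> I"
  shows "\<forall>\<^sub>F y in at x. f y \<noteq> 0"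
proof -
  have "\<not> (\<forall>\<^sub>F y in nhds x. f y = 0)"
    using real_analytic_at_identity_interval[of I f x a] assms by metis
  then show ?thesis using real_analytic_at_isolated_zeros[OF assms(2)[OF assms(5)]] by simp
qed

text \<open>The holomorphic extension of \<open>h\<close> has nonzero derivative, hence a local holomorphic inverse, and
  this inverse extends \<open>g\<close> because \<open>g\<close> is continuous.\<close>
lemma real_analytic_at_inverse:
  assumes H: "real_analytic_at h (g y0)" and d: "(h has_real_derivative d) (at (g y0))" "d \<noteq> 0"
    and g: "isCont g y0" and inv: "\<forall>\<^sub>F y in nhds y0. h (g y) = y"
  shows "real_analytic_at g y0"
proof -
  from H obtain F where F: "F analytic_on {complex_of_real (g y0)}"
     "\<forall>\<^sub>F y in nhds (g y0). F (complex_of_real y) = complex_of_real (h y)"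
    unfolding real_analytic_at_def by blast
  obtain A where A: "open A" "complex_of_real (g y0) \<in> A" "F holomorphic_on A"
    using F(1) by (auto simp: analytic_at)
  have dF: "(F has_field_derivative deriv F (of_real (g y0))) (at (of_real (g y0)))"
    using A holomorphic_derivI[of F A] by auto
  from holomorphic_real_restriction_deriv(1)[OF F(2) dF] have "Re (deriv F (of_real (g y0))) = d"
    using d(1) DERIV_unique by blast
  then have "deriv F (of_real (g y0)) \<noteq> 0" using d(2) by auto
  then obtain r where r: "r > 0" "ball (of_real (g y0)) r \<subseteq> A" "inj_on F (ball (of_real (g y0)) r)"
    using has_complex_derivative_locally_injective[OF A(3,2,1)] by blast
  let ?B = "ball (complex_of_real (g y0)) r"
  have hol: "F holomorphic_on ?B" using A(3) r(2) by (rule holomorphic_on_subset)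
  have "\<exists>G. G holomorphic_on (F ` ?B) \<and> (\<forall>z\<in>?B. G (F z) = z)"
    by (rule holomorphic_has_inverse[OF hol open_ball r(3)]) blast
  then obtain G where G: "G holomorphic_on (F ` ?B)" "\<forall>z\<in>?B. G (F z) = z" by blast
  have op: "open (F ` ?B)" by (rule open_mapping_thm3[OF hol open_ball r(3)])
  have "h (g y0) = y0" using eventually_nhds_x_imp_x[OF inv] .
  then have "F (of_real (g y0)) = of_real y0" using real_analytic_at_value[OF F(2)] by simp
  then have "of_real y0 \<in> F ` ?B" using r(1) by (metis centre_in_ball imageI)
  then have an: "G analytic_on {complex_of_real y0}" using op G(1) analytic_at by blast
  have gl: "filterlim g (nhds (g y0)) (nhds y0)" using g by (rule isCont_tendsto_nhds)
  have "\<forall>\<^sub>F y in nhds y0. F (complex_of_real (g y)) = complex_of_real (h (g y))"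
    by (rule eventually_compose_filterlim[OF F(2) gl])
  moreover have "\<forall>\<^sub>F u in nhds (g y0). u \<in> ball (g y0) r"
    using r(1) by (intro eventually_nhds_in_open) auto
  then have "\<forall>\<^sub>F y in nhds y0. g y \<in> ball (g y0) r"
    using gl by (rule eventually_compose_filterlim)
  ultimately have "\<forall>\<^sub>F y in nhds y0. G (complex_of_real y) = complex_of_real (g y)"
    using inv
  proof eventually_elim
    case (elim y)
    have "complex_of_real (g y) \<in> ?B" using elim(2) by (simp add: dist_of_real)
    with G(2) elim show ?case by metis
  qed
  with an show ?thesis unfolding real_analytic_at_def by blast
qed

text \<open>A holomorphic primitive of the extension of \<open>v\<close> differs from \<open>h\<close> by a constant on the real axis.\<close>
lemma real_analytic_at_antiderivative:
  assumes "real_analytic_at v x" "\<forall>\<^sub>F y in nhds x. (h has_real_derivative v y) (at y)"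
  shows "real_analytic_at h x"
proof -
  from assms obtain V where V: "V analytic_on {complex_of_real x}"
     "\<forall>\<^sub>F y in nhds x. V (complex_of_real y) = complex_of_real (v y)"
    unfolding real_analytic_at_def by blast
  obtain r where r: "r > 0" "V holomorphic_on ball (complex_of_real x) r"
    using V(1) by (auto simp: analytic_at_ball)
  have "\<exists>P. \<forall>z\<in>ball (complex_of_real x) r. (P has_field_derivative V z) (at z within ball (complex_of_real x) r)"
    by (rule holomorphic_convex_primitive'[OF convex_ball open_ball r(2)]) blast
  then obtain P where P: "\<And>z. z \<in> ball (complex_of_real x) r \<Longrightarrow> (P has_field_derivative V z) (at z within ball (complex_of_real x) r)"
    by blast
  have P': "(P has_field_derivative V z) (at z)" if "z \<in> ball (complex_of_real x) r" for z
    using P[OF that] unfolding at_within_open[OF that open_ball] .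
  have "\<forall>\<^sub>F y in nhds x. V (complex_of_real y) = complex_of_real (v y) \<and> (h has_real_derivative v y) (at y)"
    by (rule eventually_conj[OF V(2) assms(2)])
  then obtain e where e: "e > 0" "\<And>y. \<bar>y - x\<bar> < e \<Longrightarrow> V (complex_of_real y) = complex_of_real (v y)"
     "\<And>y. \<bar>y - x\<bar> < e \<Longrightarrow> (h has_real_derivative v y) (at y)" 
    unfolding eventually_nhds_metric dist_real_def by metis
  define d where "d = min r e"
  define D where "D y = P (complex_of_real y) - complex_of_real (h y)" for y
  have D: "(D has_vector_derivative 0) (at y within ball x d)" if "y \<in> ball x d" for y
  proof -
    from that have y: "\<bar>y - x\<bar> < e" "complex_of_real y \<in> ball (complex_of_real x) r"
      by (auto simp: d_def dist_real_def dist_of_real dist_commute)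
    have "((\<lambda>y. P (complex_of_real y)) has_vector_derivative V (of_real y)) (at y)"
      using field_vector_diff_chain_at[of complex_of_real 1 y P] P'[OF y(2)]
      by (auto simp: o_def intro!: has_vector_derivative_real_field derivative_eq_intros)
    moreover have "((\<lambda>y. complex_of_real (h y)) has_vector_derivative of_real (v y)) (at y)"
      using e(3)[OF y(1)] by (intro has_vector_derivative_of_real) (simp add: has_real_derivative_iff_has_vector_derivative)
    ultimately have "(D has_vector_derivative (V (of_real y) - of_real (v y))) (at y)"
      unfolding D_def by (rule has_vector_derivative_diff)
    then show ?thesis using e(2)[OF y(1)] by (simp add: has_vector_derivative_at_within)
  qed
  obtain c where c: "\<And>y. y \<in> ball x d \<Longrightarrow> D y = c"
    using has_vector_derivative_zero_constant[OF convex_ball D] by blast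
  have "d > 0" using r e by (simp add: d_def)
  have "P analytic_on {complex_of_real x}"
    unfolding analytic_at_ball using r(1) P' by (metis holomorphic_on_open open_ball)
  then have "(\<lambda>z. P z - c) analytic_on {complex_of_real x}" by (intro analytic_on_diff) auto
  moreover have "\<forall>\<^sub>F y in nhds x. y \<in> ball x d"
    using \<open>d > 0\<close> by (intro eventually_nhds_in_open) auto
  then have "\<forall>\<^sub>F y in nhds x. P (complex_of_real y) - c = complex_of_real (h y)"
    by eventually_elim (use c in \<open>force simp: D_def\<close>)
  ultimately show ?thesis unfolding real_analytic_at_def by (intro exI[of _ "\<lambda>z. P z - c"]) auto
qed

section \<open>Power series and analytic curves\<close>

lemma real_analytic_at_power_series:
  assumes "r > 0" "\<And>y. \<bar>y - x\<bar> < r \<Longrightarrow> (\<lambda>n. (y - x) ^ n * a n) sums f y"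
  shows "real_analytic_at f x"
proof -
  define F where "F z = (\<Sum>n. complex_of_real (a n) * (z - complex_of_real x) ^ n)" for z
  have sm: "(\<lambda>n. complex_of_real (a n) * (w - complex_of_real x) ^ n) sums F w" if w: "w \<in> ball (complex_of_real x) r" for w
  proof -
    have lt: "cmod (w - complex_of_real x) < r" using w by (simp add: dist_norm norm_minus_commute)
    then obtain \<rho> where \<rho>: "cmod (w - complex_of_real x) < \<rho>" "\<rho> < r" using dense by blast
    have "\<rho> > 0" using \<rho>(1) by (smt (verit) norm_ge_zero)
    then have "summable (\<lambda>n. complex_of_real (a n * \<rho> ^ n))"
      using assms(2)[of "x + \<rho>"] \<rho>(2) by (intro summable_of_real) (auto simp: sums_iff mult.commute)
    then have "summable (\<lambda>n. complex_of_real (a n) * complex_of_real \<rho> ^ n)" by simp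
    from powser_inside[OF this, of "w - complex_of_real x"] \<rho>(1) \<open>\<rho> > 0\<close> show ?thesis
      unfolding F_def by (intro summable_sums) simp
  qed
  have "F analytic_on {complex_of_real x}"
    by (rule analytic_on_subset[OF power_series_analytic[OF sm]]) (use assms(1) in auto)
  moreover have "F (complex_of_real y) = complex_of_real (f y)" if "\<bar>y - x\<bar> < r" for y
  proof -
    have "(\<lambda>n. complex_of_real ((y - x) ^ n * a n)) sums of_real (f y)"
      using assms(2)[OF that] by (rule sums_of_real)
    moreover have "(\<lambda>n. complex_of_real (a n) * (of_real y - complex_of_real x) ^ n) sums F (of_real y)"
      using that by (intro sm) (simp add: dist_of_real dist_real_def abs_minus_commute)
    ultimately show ?thesis by (simp add: sums_iff mult.commute)
  qed
  then have "\<forall>\<^sub>F y in nhds x. F (complex_of_real y) = complex_of_real (f y)"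
    unfolding eventually_nhds_metric dist_real_def using assms(1) by blast
  ultimately show ?thesis unfolding real_analytic_at_def by blast
qed

text \<open>The Taylor coefficients of the extension may be replaced by their real parts, since the sum is real.\<close>
lemma real_analytic_at_imp_power_series:
  assumes "real_analytic_at f x"
  shows "\<exists>a r. r > 0 \<and> (\<forall>y. \<bar>y - x\<bar> < r \<longrightarrow> (\<lambda>n. (y - x) ^ n * a n) sums f y)"
proof -
  from assms obtain F where F: "F analytic_on {complex_of_real x}"
     "\<forall>\<^sub>F y in nhds x. F (complex_of_real y) = complex_of_real (f y)"
    unfolding real_analytic_at_def by blast
  obtain r where r: "r > 0" "F holomorphic_on ball (complex_of_real x) r"
    using F(1) by (auto simp: analytic_at_ball)
  obtain e where e: "e > 0" "\<And>y. \<bar>y - x\<bar> < e \<Longrightarrow> F (complex_of_real y) = complex_of_real (f y)"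
    using F(2) unfolding eventually_nhds_metric dist_real_def by blast
  define b where "b n = (deriv ^^ n) F (complex_of_real x) / fact n" for n
  have "(\<lambda>n. (y - x) ^ n * Re (b n)) sums f y" if "\<bar>y - x\<bar> < min r e" for y
  proof -
    have "(\<lambda>n. b n * (complex_of_real y - complex_of_real x) ^ n) sums F (complex_of_real y)"
      unfolding b_def using that
      by (intro holomorphic_power_series[OF r(2)]) (simp add: dist_of_real dist_real_def abs_minus_commute)
    then have "(\<lambda>n. Re (b n * complex_of_real ((y - x) ^ n))) sums Re (F (complex_of_real y))"
      by (intro sums_Re) simp
    then show ?thesis using e(2)[of y] that by (simp add: mult.commute)
  qed
  then show ?thesis using r(1) e(1) by (intro exI[of _ "\<lambda>n. Re (b n)"] exI[of _ "min r e"]) simp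
qed

text \<open>Analyticity of curves is tested on the coordinates, so that inner and cross products reduce to
  sums and products of real functions.\<close>
definition vec_analytic_at :: "(real \<Rightarrow> real^3) \<Rightarrow> real \<Rightarrow> bool" where
  "vec_analytic_at u x \<longleftrightarrow> (\<forall>i. real_analytic_at (\<lambda>y. u y $ i) x)"

lemma real_analytic_on_iff_vec_analytic_at: "real_analytic_on u S \<longleftrightarrow> (\<forall>x\<in>S. vec_analytic_at u x)"
proof
  assume L: "real_analytic_on u S"
  show "\<forall>x\<in>S. vec_analytic_at u x" unfolding vec_analytic_at_def
  proof (intro ballI allI)
    fix x i assume "x \<in> S"
    then obtain a r where "r > 0" "\<And>y. \<bar>y - x\<bar> < r \<Longrightarrow> (\<lambda>n. (y - x) ^ n *\<^sub>R a n) sums u y"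
      using L unfolding real_analytic_on_def by blast
    then show "real_analytic_at (\<lambda>y. u y $ i) x"
      using sums_vec_nth[where i = i] by (intro real_analytic_at_power_series[where a = "\<lambda>n. a n $ i"]) force+
  qed
next
  assume R: "\<forall>x\<in>S. vec_analytic_at u x"
  show "real_analytic_on u S" unfolding real_analytic_on_def
  proof
    fix x assume "x \<in> S"
    then have "\<forall>i. \<exists>a r. r > 0 \<and> (\<forall>y. \<bar>y - x\<bar> < r \<longrightarrow> (\<lambda>n. (y - x) ^ n * a n) sums (u y $ i))"
      using R real_analytic_at_imp_power_series unfolding vec_analytic_at_def by simp
    then obtain a r where ar: "\<And>i. r i > 0" 
      "\<And>i y. \<bar>y - x\<bar> < r i \<Longrightarrow> (\<lambda>n. (y - x) ^ n * a i n) sums (u y $ i)"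
      by metis
    have sums: "(\<lambda>n. (y - x) ^ n *\<^sub>R (\<chi> i. a i n)) sums u y" if y: "\<bar>y - x\<bar> < Min (range r)" for y
    proof -
      have "\<bar>y - x\<bar> < r i" for i using y by simp
      then have "(\<lambda>n. (y - x) ^ n * a i n) sums (u y $ i)" for i by (rule ar)
      then show ?thesis unfolding sums_def by (intro vec_tendstoI) simp
    qed
    have "Min (range r) > 0" using ar(1) by (subst Min_gr_iff) auto
    with sums show "\<exists>a. \<exists>r>0. \<forall>y. \<bar>y - x\<bar> < r \<longrightarrow> (\<lambda>n. (y - x) ^ n *\<^sub>R a n) sums u y"
      by (intro exI[of _ "\<lambda>n. \<chi> i. a i n"] exI[of _ "Min (range r)"]) simp
  qed
qed

lemma vec_analytic_at_add: "vec_analytic_at u x \<Longrightarrow> vec_analytic_at w x \<Longrightarrow> vec_analytic_at (\<lambda>y. u y + w y) x"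
  by (simp add: vec_analytic_at_def real_analytic_at_add)

lemma vec_analytic_at_scaleR: "real_analytic_at f x \<Longrightarrow> vec_analytic_at u x \<Longrightarrow> vec_analytic_at (\<lambda>y. f y *\<^sub>R u y) x"
  by (simp add: vec_analytic_at_def real_analytic_at_mult)

lemma vec_analytic_at_inner: "vec_analytic_at u x \<Longrightarrow> vec_analytic_at w x \<Longrightarrow> real_analytic_at (\<lambda>y. u y \<bullet> w y) x"
  by (simp add: vec_analytic_at_def inner_vec_def sum_3 real_analytic_at_add real_analytic_at_mult)

lemma vec_analytic_at_cross: "vec_analytic_at u x \<Longrightarrow> vec_analytic_at w x \<Longrightarrow> vec_analytic_at (\<lambda>y. cross3 (u y) (w y)) x"
  by (simp add: vec_analytic_at_def cross3_simps(1) forall_3 real_analytic_at_diff real_analytic_at_mult)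

lemma vec_analytic_at_compose: "real_analytic_at f x \<Longrightarrow> vec_analytic_at u (f x) \<Longrightarrow> vec_analytic_at (\<lambda>y. u (f y)) x"
  unfolding vec_analytic_at_def using real_analytic_at_compose[of f x "\<lambda>y. u y $ i" for i] by blast

lemma vec_analytic_at_cong: "vec_analytic_at u x \<Longrightarrow> \<forall>\<^sub>F y in nhds x. u y = w y \<Longrightarrow> vec_analytic_at w x"
  unfolding vec_analytic_at_def
proof
  fix i assume u: "\<forall>i. real_analytic_at (\<lambda>y. u y $ i) x" and e: "\<forall>\<^sub>F y in nhds x. u y = w y"
  have "\<forall>\<^sub>F y in nhds x. u y $ i = w y $ i" using e by eventually_elim simp
  then show "real_analytic_at (\<lambda>y. w y $ i) x" using u by (blast intro: real_analytic_at_cong)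
qed

lemma vec_analytic_at_has_vector_derivative:
  assumes "vec_analytic_at u x"
  shows "(u has_vector_derivative vector_derivative u (at x)) (at x)"
    and "vec_analytic_at (\<lambda>y. vector_derivative u (at y)) x"
proof -
  have vd: "(u has_vector_derivative (\<chi> i. deriv (\<lambda>y. u y $ i) y)) (at y)"
    if "\<And>i. ((\<lambda>y. u y $ i) has_real_derivative deriv (\<lambda>y. u y $ i) y) (at y)" for y
    unfolding has_vector_derivative_def
  proof (subst has_derivative_componentwise_within, intro ballI)
    fix b :: "real^3" assume "b \<in> Basis"
    then obtain i where b: "b = axis i 1" by (auto simp: Basis_vec_def)
    have "((\<lambda>y. u y $ i) has_derivative (\<lambda>t. t * deriv (\<lambda>y. u y $ i) y)) (at y)"
      using that[of i] by (simp add: has_field_derivative_def mult_commute_abs)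
    then show "((\<lambda>y. u y \<bullet> b) has_derivative (\<lambda>t. (t *\<^sub>R (\<chi> i. deriv (\<lambda>y. u y $ i) y)) \<bullet> b)) (at y)"
      by (simp add: b inner_axis)
  qed
  have ev: "\<forall>\<^sub>F y in nhds x. \<forall>i. ((\<lambda>y. u y $ i) has_real_derivative deriv (\<lambda>y. u y $ i) y) (at y)"
    using assms unfolding vec_analytic_at_def by (intro eventually_all_finite) (auto intro: real_analytic_at_deriv)
  then have e: "\<forall>\<^sub>F y in nhds x. (\<chi> i. deriv (\<lambda>y. u y $ i) y) = vector_derivative u (at y)"
    by eventually_elim (rule vector_derivative_at[symmetric], rule vd, blast)
  have "vec_analytic_at (\<lambda>y. \<chi> i. deriv (\<lambda>y. u y $ i) y) x"
    using assms unfolding vec_analytic_at_def vec_lambda_beta by (blast intro: real_analytic_at_deriv(2))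
  then show "vec_analytic_at (\<lambda>y. vector_derivative u (at y)) x"
    using e by (rule vec_analytic_at_cong)
  have "\<And>i. ((\<lambda>y. u y $ i) has_real_derivative deriv (\<lambda>y. u y $ i) x) (at x)"
    using eventually_nhds_x_imp_x[OF ev] by blast
  then have "u differentiable at x" using vd differentiableI_vector by blast
  then show "(u has_vector_derivative vector_derivative u (at x)) (at x)"
    by (simp add: vector_derivative_works)
qed

text \<open>The interval may be unbounded and contains no endpoint to integrate from, so the primitive is the
  signed integral from an interior point: of the two integrals, one is over an empty or
  one-point set.\<close>
lemma primitive_on_open_interval:
  fixes v :: "real \<Rightarrow> real"
  assumes "open I" "is_interval I" "continuous_on I v"
  obtains h where "\<And>s. s \<in> I \<Longrightarrow> (h has_real_derivative v s) (at s)"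
proof (cases "I = {}")
  case False
  then obtain s0 where s0: "s0 \<in> I" by blast
  define h where "h s = integral {s0..s} v - integral {s..s0} v" for s
  have "(h has_real_derivative v s) (at s)" if s: "s \<in> I" for s
  proof -
    obtain e where e: "e > 0" "cball s0 e \<subseteq> I" using assms(1) s0 open_contains_cball by blast
    obtain e' where e': "e' > 0" "cball s e' \<subseteq> I" using assms(1) s open_contains_cball by blast
    define a where "a = min (s0 - e) (s - e')"
    define b where "b = max (s0 + e) (s + e')"
    have "s0 - e \<in> I" "s0 + e \<in> I" "s - e' \<in> I" "s + e' \<in> I" 
      using e e' by (simp_all add: subset_eq dist_real_def)
    then have "a \<in> I" "b \<in> I" by (simp_all add: a_def b_def min_def max_def)
    then have sub: "{a..b} \<subseteq> I" using assms(2) unfolding is_interval_1 atLeastAtMost_iff subset_iff by blast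
    have ab: "a < s0" "s0 < b" "a < s" "s < b" using e e' by (simp_all add: a_def b_def)
    have cont: "continuous_on {a..b} v" using assms(3) sub by (rule continuous_on_subset)
    have int: "v integrable_on {p..q}" if "a \<le> p" "q \<le> b" for p q
      using that by (intro integrable_continuous_real continuous_on_subset[OF cont]) auto
    have heq: "h u = integral {a..u} v - integral {a..s0} v" if "u \<in> {a..b}" for u
    proof (cases "s0 \<le> u")
      case True
      then have "integral {a..s0} v + integral {s0..u} v = integral {a..u} v"
        using that ab by (intro Henstock_Kurzweil_Integration.integral_combine int) auto
      moreover have "integral {u..s0} v = 0" using True by (cases "u = s0") auto
      ultimately show ?thesis by (simp add: h_def)
    next
      case False
      then have "integral {a..u} v + integral {u..s0} v = integral {a..s0} v"
        using that ab by (intro Henstock_Kurzweil_Integration.integral_combine int) auto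
      then show ?thesis using False by (simp add: h_def)
    qed
    have "((\<lambda>u. integral {a..u} v) has_real_derivative v s) (at s within {a..b})"
      using integral_has_real_derivative[OF cont, of s] ab by auto
    then have "((\<lambda>u. integral {a..u} v - integral {a..s0} v) has_real_derivative v s) (at s within {a..b})"
      by (auto intro!: derivative_eq_intros)
    then have "(h has_real_derivative v s) (at s within {a..b})"
      by (rule has_field_derivative_transform_within[of _ _ _ _ 1]) (use heq ab in auto)
    moreover have "at s within {a..b} = at s" using ab by (intro at_within_interior) auto
    ultimately show ?thesis by simp
  qed
  then show thesis by (rule that)
qed auto

section \<open>Frenet formulas\<close>

text \<open>The part \<open>y\<close> of \<open>x\<close> orthogonal to \<open>t\<close> and \<open>n\<close> has vanishing cross product with \<open>t \<times> n\<close>. Hence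
  equality holds in the Cauchy-Schwarz inequality for \<open>y\<close> and the unit vector \<open>t \<times> n\<close>.\<close>
lemma orthonormal_expansion:
  fixes t n x :: "real^3"
  assumes "t \<bullet> t = 1" "n \<bullet> n = 1" "t \<bullet> n = 0"
  shows "x = (x \<bullet> t) *\<^sub>R t + (x \<bullet> n) *\<^sub>R n + (x \<bullet> cross3 t n) *\<^sub>R cross3 t n"
proof -
  define b where "b = cross3 t n"
  define y where "y = x - (x \<bullet> t) *\<^sub>R t - (x \<bullet> n) *\<^sub>R n"
  have bt: "b \<bullet> t = 0" "b \<bullet> n = 0" "t \<bullet> b = 0" "n \<bullet> b = 0" by (simp_all add: b_def dot_cross_self)
  have yt: "y \<bullet> t = 0" "y \<bullet> n = 0"
    using assms by (simp_all add: y_def inner_diff_left inner_commute[of n t])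
  have bb: "b \<bullet> b = 1"
    using norm_cross_dot[of t n] assms by (simp add: b_def power2_norm_eq_inner power_mult_distrib)
  have "cross3 y b = (y \<bullet> n) *\<^sub>R t - (y \<bullet> t) *\<^sub>R n"
    unfolding b_def by (simp add: cross3_simps forall_3)
  then have "cross3 y b = 0" using yt by simp
  then have "(y \<bullet> b)\<^sup>2 = y \<bullet> y"
    using norm_cross_dot[of y b] bb by (simp add: power2_norm_eq_inner power_mult_distrib)
  then have "(y - (y \<bullet> b) *\<^sub>R b) \<bullet> (y - (y \<bullet> b) *\<^sub>R b) = 0"
    using bb by (simp add: inner_diff_left inner_diff_right inner_commute[of b y] power2_eq_square)
  then have "y = (y \<bullet> b) *\<^sub>R b" by simp
  moreover have "y \<bullet> b = x \<bullet> b" by (simp add: y_def inner_diff_left bt)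
  ultimately have "y = (x \<bullet> b) *\<^sub>R b" by simp
  then have "x - (x \<bullet> t) *\<^sub>R t - (x \<bullet> n) *\<^sub>R n = (x \<bullet> b) *\<^sub>R b" unfolding y_def .
  then show ?thesis unfolding b_def by (metis add.commute add.left_commute diff_add_cancel)
qed

lemma has_vector_derivative_inner:
  assumes "(u has_vector_derivative u') (at s)" "(w has_vector_derivative w') (at s)"
  shows "((\<lambda>y. u y \<bullet> w y) has_real_derivative (u s \<bullet> w' + u' \<bullet> w s)) (at s)"
  using bounded_bilinear.has_vector_derivative[OF bounded_bilinear_inner assms]
  by (simp add: has_real_derivative_iff_has_vector_derivative)

lemma has_vector_derivative_inner_const:
  assumes "(u has_vector_derivative u') (at s)" "(w has_vector_derivative w') (at s)"
    and "\<forall>\<^sub>F y in nhds s. u y \<bullet> w y = c"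
  shows "u s \<bullet> w' + u' \<bullet> w s = 0"
proof -
  have "((\<lambda>y. c) has_real_derivative (u s \<bullet> w' + u' \<bullet> w s)) (at s)"
    using has_vector_derivative_inner[OF assms(1,2)] DERIV_cong_ev[OF refl assms(3) refl] by blast
  then show ?thesis using DERIV_unique DERIV_const by blast
qed

lemma frame_analytic:
  assumes "space_curve I \<phi>" "s \<in> I"
  shows "vec_analytic_at \<phi> s" "vec_analytic_at (frame_T \<phi>) s" "vec_analytic_at (frame_N \<phi>) s"
    "vec_analytic_at (\<lambda>y. vector_derivative (frame_N \<phi>) (at y)) s"
    "(\<phi> has_vector_derivative frame_T \<phi> s) (at s)"
    "(frame_T \<phi> has_vector_derivative frame_N \<phi> s) (at s)"
    "(frame_N \<phi> has_vector_derivative vector_derivative (frame_N \<phi>) (at s)) (at s)"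
proof -
  have T: "frame_T \<phi> = (\<lambda>y. vector_derivative \<phi> (at y))" by (simp add: fun_eq_iff frame_T_def)
  have N: "frame_N \<phi> = (\<lambda>y. vector_derivative (frame_T \<phi>) (at y))" by (simp add: fun_eq_iff frame_N_def)
  show 0: "vec_analytic_at \<phi> s" using assms by (simp add: space_curve_def real_analytic_on_iff_vec_analytic_at)
  show 1: "vec_analytic_at (frame_T \<phi>) s" unfolding T by (rule vec_analytic_at_has_vector_derivative[OF 0])
  show 2: "vec_analytic_at (frame_N \<phi>) s" unfolding N by (rule vec_analytic_at_has_vector_derivative[OF 1])
  show "vec_analytic_at (\<lambda>y. vector_derivative (frame_N \<phi>) (at y)) s" by (rule vec_analytic_at_has_vector_derivative[OF 2])
  show "(\<phi> has_vector_derivative frame_T \<phi> s) (at s)"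
    unfolding frame_T_def by (rule vec_analytic_at_has_vector_derivative[OF 0])
  show "(frame_T \<phi> has_vector_derivative frame_N \<phi> s) (at s)"
    unfolding frame_N_def by (rule vec_analytic_at_has_vector_derivative[OF 1])
  show "(frame_N \<phi> has_vector_derivative vector_derivative (frame_N \<phi>) (at s)) (at s)"
    by (rule vec_analytic_at_has_vector_derivative[OF 2])
qed

lemma space_curve_nhds: "space_curve I \<phi> \<Longrightarrow> s \<in> I \<Longrightarrow> \<forall>\<^sub>F y in nhds s. y \<in> I"
  unfolding space_curve_def by (blast intro: eventually_nhds_in_open)

lemma frame_T_unit: "space_curve I \<phi> \<Longrightarrow> s \<in> I \<Longrightarrow> frame_T \<phi> s \<bullet> frame_T \<phi> s = 1"
  by (simp add: space_curve_def dot_square_norm)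

lemma frame_T_N_orthogonal:
  assumes "space_curve I \<phi>" "s \<in> I"
  shows "frame_T \<phi> s \<bullet> frame_N \<phi> s = 0"
proof -
  have "\<forall>\<^sub>F y in nhds s. frame_T \<phi> y \<bullet> frame_T \<phi> y = 1"
    using space_curve_nhds[OF assms] by eventually_elim (rule frame_T_unit[OF assms(1)])
  from has_vector_derivative_inner_const[OF frame_analytic(6,6)[OF assms] this]
  show ?thesis by (simp add: inner_commute)
qed

lemma curvature_sq: "(curvature \<phi> s)\<^sup>2 = frame_N \<phi> s \<bullet> frame_N \<phi> s"
  by (simp add: curvature_def power2_norm_eq_inner)

text \<open>The numerator \<open>det (\<phi>', \<phi>'', \<phi>''')\<close> of the torsion. Unlike the torsion it is analytic on
  the whole interval.\<close>
definition triple :: "(real \<Rightarrow> real^3) \<Rightarrow> real \<Rightarrow> real" where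
  "triple \<phi> s = frame_T \<phi> s \<bullet> cross3 (frame_N \<phi> s) (vector_derivative (frame_N \<phi>) (at s))"

lemma torsion_quotient_triple: "torsion_quotient \<phi> s = triple \<phi> s / (curvature \<phi> s)\<^sup>2"
  by (simp add: torsion_quotient_def triple_def dot_cross_det)

lemma real_analytic_at_curvature_sq: 
  assumes "space_curve I \<phi>" "s \<in> I" shows "real_analytic_at (\<lambda>y. (curvature \<phi> y)\<^sup>2) s"
  unfolding curvature_sq by (intro vec_analytic_at_inner frame_analytic[OF assms])

lemma real_analytic_at_triple: 
  assumes "space_curve I \<phi>" "s \<in> I" shows "real_analytic_at (triple \<phi>) s"
  unfolding triple_def by (intro vec_analytic_at_inner vec_analytic_at_cross frame_analytic[OF assms])

lemma isCont_curvature: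
  assumes "space_curve I \<phi>" "s \<in> I" shows "isCont (curvature \<phi>) s"
  unfolding curvature_def
  using frame_analytic(7)[OF assms] by (intro continuous_norm has_vector_derivative_continuous)

lemma curvature_nonzero_punctured:
  assumes "space_curve I \<phi>" "s \<in> I" shows "\<forall>\<^sub>F y in at s. curvature \<phi> y \<noteq> 0"
proof -
  obtain a where "a \<in> I" "curvature \<phi> a \<noteq> 0" using assms by (auto simp: space_curve_def)
  then have "\<forall>\<^sub>F y in at s. (curvature \<phi> y)\<^sup>2 \<noteq> 0"
    using assms real_analytic_at_curvature_sq[OF assms(1)]
    by (intro real_analytic_at_isolated_zeros_interval[of I _ a]) (auto simp: space_curve_def)
  then show ?thesis by simp
qed

text \<open>The Frenet equation \<open>n' = - \<kappa> t + \<tau> b\<close> for a unit normal field \<open>n\<close> with \<open>t' = k n\<close>. Since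
  the formula does not divide by \<open>k\<close>, it also serves at the zeros of the curvature; there \<open>\<tau>\<close> has to be
  read as \<open>t \<bullet> (n \<times> n')\<close>.\<close>
lemma unit_normal_derivative:
  assumes "space_curve I \<phi>" "s \<in> I" and d: "(n has_vector_derivative d) (at s)"
    and nn: "\<forall>\<^sub>F y in nhds s. n y \<bullet> n y = 1" and Tn: "\<forall>\<^sub>F y in nhds s. frame_T \<phi> y \<bullet> n y = 0"
    and N: "frame_N \<phi> s = k *\<^sub>R n s"
  shows "d = (- k) *\<^sub>R frame_T \<phi> s + (frame_T \<phi> s \<bullet> cross3 (n s) d) *\<^sub>R cross3 (frame_T \<phi> s) (n s)"
proof -
  note [simp] = eventually_nhds_x_imp_x[OF nn] eventually_nhds_x_imp_x[OF Tn] frame_T_unit[OF assms(1,2)]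
  have 1: "n s \<bullet> d = 0"
    using has_vector_derivative_inner_const[OF d d nn] by (simp add: inner_commute)
  have 2: "frame_T \<phi> s \<bullet> d = - k"
    using has_vector_derivative_inner_const[OF frame_analytic(6)[OF assms(1,2)] d Tn] by (simp add: N)
  have 3: "d \<bullet> cross3 (frame_T \<phi> s) (n s) = frame_T \<phi> s \<bullet> cross3 (n s) d"
    by (simp add: cross3_simps)
  show ?thesis
    using orthonormal_expansion[of "frame_T \<phi> s" "n s" d] 1 2 3 by (simp add: inner_commute[of d])
qed

lemma torsion_quotient_unit_normal:
  assumes "space_curve I \<phi>" "s \<in> I" and d: "(n has_vector_derivative d) (at s)"
    and k: "(k has_real_derivative k') (at s)" "k s = curvature \<phi> s" "curvature \<phi> s \<noteq> 0"
    and N: "\<forall>\<^sub>F y in nhds s. frame_N \<phi> y = k y *\<^sub>R n y"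
  shows "torsion_quotient \<phi> s = frame_T \<phi> s \<bullet> cross3 (n s) d"
proof -
  have "((\<lambda>y. k y *\<^sub>R n y) has_vector_derivative (k s *\<^sub>R d + k' *\<^sub>R n s)) (at s)"
    using k(1) d by (rule has_vector_derivative_scaleR)
  then have "(frame_N \<phi> has_vector_derivative (k s *\<^sub>R d + k' *\<^sub>R n s)) (at s)"
    using has_vector_derivative_cong_ev[where S = UNIV and x = s and f = "frame_N \<phi>" and g = "\<lambda>y. k y *\<^sub>R n y"]
      N eventually_nhds_x_imp_x[OF N] by simp
  then have "vector_derivative (frame_N \<phi>) (at s) = k s *\<^sub>R d + k' *\<^sub>R n s"
    by (rule vector_derivative_at)
  then have "triple \<phi> s = (k s)\<^sup>2 * (frame_T \<phi> s \<bullet> cross3 (n s) d)"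
    unfolding triple_def using eventually_nhds_x_imp_x[OF N]
    by (simp add: cross_add_right cross_mult_left cross_mult_right power2_eq_square)
  then show ?thesis using k by (simp add: torsion_quotient_triple)
qed

definition principal_normal :: "(real \<Rightarrow> real^3) \<Rightarrow> real \<Rightarrow> real^3" where
  "principal_normal \<phi> s = (1 / curvature \<phi> s) *\<^sub>R frame_N \<phi> s"

lemma principal_normal_simps:
  assumes "curvature \<phi> s \<noteq> 0"
  shows "frame_N \<phi> s = curvature \<phi> s *\<^sub>R principal_normal \<phi> s"
    "principal_normal \<phi> s \<bullet> principal_normal \<phi> s = 1"
  using assms curvature_sq[of \<phi> s, symmetric] by (simp_all add: principal_normal_def power2_eq_square)

lemma real_analytic_at_curvature:
  assumes "space_curve I \<phi>" "s \<in> I" "curvature \<phi> s \<noteq> 0" shows "real_analytic_at (curvature \<phi>) s"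
proof -
  have "real_analytic_at (\<lambda>y. sqrt ((curvature \<phi> y)\<^sup>2)) s"
    using real_analytic_at_sqrt[OF real_analytic_at_curvature_sq[OF assms(1,2)]] assms(3) by simp
  moreover have "(\<lambda>y. sqrt ((curvature \<phi> y)\<^sup>2)) = curvature \<phi>" by (simp add: fun_eq_iff curvature_def)
  ultimately show ?thesis by simp
qed

lemma principal_normal_has_derivative:
  assumes "space_curve I \<phi>" "s \<in> I" "curvature \<phi> s \<noteq> 0"
  obtains d where "(principal_normal \<phi> has_vector_derivative d) (at s)"
    "frame_T \<phi> s \<bullet> d = - curvature \<phi> s" "principal_normal \<phi> s \<bullet> d = 0"
    "d \<bullet> d = (curvature \<phi> s)\<^sup>2 + (torsion_quotient \<phi> s)\<^sup>2"
proof -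
  have rk: "real_analytic_at (curvature \<phi>) s" by (rule real_analytic_at_curvature[OF assms])
  have "vec_analytic_at (principal_normal \<phi>) s"
    unfolding principal_normal_def by (intro vec_analytic_at_scaleR real_analytic_at_divide real_analytic_at_const rk frame_analytic(3)[OF assms(1,2)] assms(3))
  then obtain d where d: "(principal_normal \<phi> has_vector_derivative d) (at s)"
    using vec_analytic_at_has_vector_derivative(1) by blast
  have "((\<lambda>y. curvature \<phi> y) \<longlongrightarrow> curvature \<phi> s) (nhds s)"
    using isCont_tendsto_nhds[OF isCont_curvature[OF assms(1,2)]] .
  then have nz: "\<forall>\<^sub>F y in nhds s. curvature \<phi> y \<noteq> 0"
    using assms(3) by (rule tendsto_imp_eventually_ne)
  have N: "\<forall>\<^sub>F y in nhds s. frame_N \<phi> y = curvature \<phi> y *\<^sub>R principal_normal \<phi> y"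
    using nz by eventually_elim (rule principal_normal_simps)
  have nn: "\<forall>\<^sub>F y in nhds s. principal_normal \<phi> y \<bullet> principal_normal \<phi> y = 1"
    using nz by eventually_elim (rule principal_normal_simps)
  have Tn: "\<forall>\<^sub>F y in nhds s. frame_T \<phi> y \<bullet> principal_normal \<phi> y = 0"
    using space_curve_nhds[OF assms(1,2)]
    by eventually_elim (simp add: principal_normal_def frame_T_N_orthogonal[OF assms(1)])
  let ?T = "frame_T \<phi> s" and ?n = "principal_normal \<phi> s" and ?\<tau> = "torsion_quotient \<phi> s"
  have \<tau>: "?\<tau> = ?T \<bullet> cross3 ?n d"
    using torsion_quotient_unit_normal[OF assms(1,2) d _ refl assms(3) N] real_analytic_at_deriv(1)[OF rk]
      eventually_nhds_x_imp_x by blast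
  have dd: "d = (- curvature \<phi> s) *\<^sub>R ?T + ?\<tau> *\<^sub>R cross3 ?T ?n"
    unfolding \<tau> by (rule unit_normal_derivative[OF assms(1,2) d nn Tn eventually_nhds_x_imp_x[OF N]])
  note [simp] = frame_T_unit[OF assms(1,2)] dot_cross_self eventually_nhds_x_imp_x[OF Tn] eventually_nhds_x_imp_x[OF nn]
  have bb: "cross3 ?T ?n \<bullet> cross3 ?T ?n = 1"
    using norm_cross_dot[of ?T ?n] by (simp add: power2_norm_eq_inner power_mult_distrib)
  show thesis
  proof
    show "(principal_normal \<phi> has_vector_derivative d) (at s)" by fact
    show "?T \<bullet> d = - curvature \<phi> s" by (subst dd) (simp add: inner_add_right inner_diff_right)
    show "?n \<bullet> d = 0" by (subst dd) (simp add: inner_add_right inner_diff_right inner_commute[of ?n ?T])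
    show "d \<bullet> d = (curvature \<phi> s)\<^sup>2 + ?\<tau>\<^sup>2"
      by (subst (1 2) dd) (simp add: inner_add_right inner_diff_right inner_add_left inner_diff_left bb power2_eq_square)
  qed
qed

lemma frame_B_norm:
  assumes "space_curve I \<phi>" "s \<in> I"
  shows "norm (frame_B \<phi> s) = curvature \<phi> s"
proof -
  have "norm (frame_T \<phi> s) = 1" using assms by (simp add: space_curve_def)
  then have "(norm (frame_B \<phi> s))\<^sup>2 = (norm (frame_N \<phi> s))\<^sup>2"
    using norm_cross_dot[of "frame_T \<phi> s" "frame_N \<phi> s"] frame_T_N_orthogonal[OF assms]
    by (simp add: frame_B_def)
  then show ?thesis unfolding curvature_def by (rule power2_eq_imp_eq) auto
qed

section \<open>The curvature relation of a Mannheim curve\<close>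

text \<open>The heart of necessity. Two points of the common line show that \<open>\<psi> \<circ> h - \<phi>\<close> and the binormal of
  \<open>\<psi>\<close> are multiples of \<open>n\<close>. The first multiple is constant because the tangents of both curves
  are orthogonal to \<open>n\<close>.\<close>
lemma mannheim_relation_on_interval:
  assumes \<phi>: "space_curve I \<phi>" and \<psi>: "space_curve J \<psi>"
    and U: "open U" "is_interval U" "U \<subseteq> I" and h: "\<And>s. s \<in> U \<Longrightarrow> h s \<in> J"
    and hd: "\<And>s. s \<in> U \<Longrightarrow> (h has_real_derivative h' s) (at s)"
    and nz: "\<And>s. s \<in> U \<Longrightarrow> curvature \<phi> s \<noteq> 0" "\<And>s. s \<in> U \<Longrightarrow> curvature \<psi> (h s) \<noteq> 0"
    and lines: "\<And>s. s \<in> U \<Longrightarrow> principal_normal_line \<phi> s = binormal_line \<psi> (h s)"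
  obtains c where "\<And>s. s \<in> U \<Longrightarrow> curvature \<phi> s = c * ((curvature \<phi> s)\<^sup>2 + (torsion_quotient \<phi> s)\<^sup>2)"
proof -
  let ?n = "principal_normal \<phi>"
  define L where "L s = (\<psi> (h s) - \<phi> s) \<bullet> ?n s" for s
  have \<psi>h: "\<psi> (h s) = \<phi> s + L s *\<^sub>R ?n s" and orth: "frame_T \<psi> (h s) \<bullet> ?n s = 0" "frame_N \<psi> (h s) \<bullet> ?n s = 0"
    if s: "s \<in> U" for s
  proof -
    \<comment> \<open>The line is determined by its points with parameters \<open>0\<close> and \<open>1\<close> on the side of \<open>\<psi>\<close>.\<close>
    have "\<psi> (h s) + 0 *\<^sub>R frame_B \<psi> (h s) \<in> binormal_line \<psi> (h s)"
      unfolding binormal_line_def by (rule rangeI)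
    then obtain r where r: "\<psi> (h s) = \<phi> s + r *\<^sub>R frame_N \<phi> s"
      using lines[OF s] by (auto simp: principal_normal_line_def)
    then have "L s = r * curvature \<phi> s"
      unfolding L_def r using principal_normal_simps[OF nz(1)[OF s]] 
      by (metis add_diff_cancel_left' inner_scaleR_left mult.right_neutral mult.assoc)
    then show "\<psi> (h s) = \<phi> s + L s *\<^sub>R ?n s"
      using r principal_normal_simps(1)[OF nz(1)[OF s]] by simp
    have "\<psi> (h s) + 1 *\<^sub>R frame_B \<psi> (h s) \<in> binormal_line \<psi> (h s)"
      unfolding binormal_line_def by (rule rangeI)
    then obtain q where "\<psi> (h s) + frame_B \<psi> (h s) = \<phi> s + q *\<^sub>R frame_N \<phi> s"
      using lines[OF s] by (auto simp: principal_normal_line_def)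
    then have "frame_B \<psi> (h s) = (q - r) *\<^sub>R frame_N \<phi> s"
      unfolding r by (simp add: algebra_simps)
    then have B: "frame_B \<psi> (h s) = ((q - r) * curvature \<phi> s) *\<^sub>R ?n s"
      using principal_normal_simps(1)[OF nz(1)[OF s]] by simp
    have "frame_B \<psi> (h s) \<noteq> 0"
      using frame_B_norm[OF \<psi> h[OF s]] nz(2)[OF s] by auto
    then have "(q - r) * curvature \<phi> s \<noteq> 0" using B by auto
    moreover have "frame_T \<psi> (h s) \<bullet> frame_B \<psi> (h s) = 0" "frame_N \<psi> (h s) \<bullet> frame_B \<psi> (h s) = 0"
      by (simp_all add: frame_B_def dot_cross_self)
    ultimately show "frame_T \<psi> (h s) \<bullet> ?n s = 0" "frame_N \<psi> (h s) \<bullet> ?n s = 0"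
      unfolding B by simp_all
  qed
  have d\<psi>: "((\<lambda>y. \<psi> (h y)) has_vector_derivative (h' s *\<^sub>R frame_T \<psi> (h s))) (at s)"
    and dT: "((\<lambda>y. frame_T \<psi> (h y)) has_vector_derivative (h' s *\<^sub>R frame_N \<psi> (h s))) (at s)" if s: "s \<in> U" for s
    using vector_diff_chain_at[of h "h' s" s] hd[OF s] frame_analytic(5,6)[OF \<psi> h[OF s]]
    by (auto simp: o_def has_real_derivative_iff_has_vector_derivative)
  have evU: "\<forall>\<^sub>F y in nhds s. y \<in> U" if "s \<in> U" for s using U(1) that by (rule eventually_nhds_in_open)
  have "(L has_real_derivative 0) (at s within U)" if s: "s \<in> U" for s
  proof -
    have sI: "s \<in> I" using s U(3) by blast
    obtain d where d: "(?n has_vector_derivative d) (at s)" "?n s \<bullet> d = 0"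
      using principal_normal_has_derivative[OF \<phi> sI nz(1)[OF s]] by blast
    have Tn: "frame_T \<phi> s \<bullet> ?n s = 0"
      by (simp add: principal_normal_def frame_T_N_orthogonal[OF \<phi> sI])
    have "((\<lambda>y. \<psi> (h y) - \<phi> y) has_vector_derivative (h' s *\<^sub>R frame_T \<psi> (h s) - frame_T \<phi> s)) (at s)"
      by (intro has_vector_derivative_diff d\<psi> s frame_analytic[OF \<phi> sI])
    from has_vector_derivative_inner[OF this d(1)]
    have "(L has_real_derivative ((\<psi> (h s) - \<phi> s) \<bullet> d + (h' s *\<^sub>R frame_T \<psi> (h s) - frame_T \<phi> s) \<bullet> ?n s)) (at s)"
      unfolding L_def .
    moreover have "(\<psi> (h s) - \<phi> s) \<bullet> d + (h' s *\<^sub>R frame_T \<psi> (h s) - frame_T \<phi> s) \<bullet> ?n s = 0"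
      using \<psi>h[OF s] orth(1)[OF s] d(2) Tn
      by (simp add: inner_diff_left)
    ultimately show ?thesis by (simp add: has_field_derivative_at_within)
  qed
  then obtain c where c: "\<And>s. s \<in> U \<Longrightarrow> L s = c"
    using has_field_derivative_zero_constant[of U L] U(2) is_interval_convex by blast
  show thesis
  proof
    fix s assume s: "s \<in> U"
    have sI: "s \<in> I" using s U(3) by blast
    obtain d where d: "(?n has_vector_derivative d) (at s)" "frame_T \<phi> s \<bullet> d = - curvature \<phi> s"
      "d \<bullet> d = (curvature \<phi> s)\<^sup>2 + (torsion_quotient \<phi> s)\<^sup>2"
      using principal_normal_has_derivative[OF \<phi> sI nz(1)[OF s]] by blast
    \<comment> \<open>Differentiate \<open>T\<^sub>\<psi> \<bullet> n = 0\<close>; the term with \<open>N\<^sub>\<psi> \<bullet> n\<close> drops out.\<close>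
    have "\<forall>\<^sub>F y in nhds s. frame_T \<psi> (h y) \<bullet> ?n y = 0"
      using evU[OF s] by eventually_elim (rule orth)
    from has_vector_derivative_inner_const[OF dT[OF s] d(1) this]
    have Td: "frame_T \<psi> (h s) \<bullet> d = 0" using orth(2)[OF s] by simp
    have "((\<lambda>y. \<phi> y + c *\<^sub>R ?n y) has_vector_derivative (frame_T \<phi> s + c *\<^sub>R d)) (at s)"
      by (auto intro!: derivative_eq_intros frame_analytic[OF \<phi> sI] d(1))
    moreover have "\<forall>\<^sub>F y in nhds s. \<psi> (h y) = \<phi> y + c *\<^sub>R ?n y"
      using evU[OF s] by eventually_elim (use \<psi>h c in auto)
    then have "((\<lambda>y. \<phi> y + c *\<^sub>R ?n y) has_vector_derivative (h' s *\<^sub>R frame_T \<psi> (h s))) (at s)"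
      using d\<psi>[OF s] has_vector_derivative_cong_ev[where S = UNIV and x = s and f = "\<lambda>y. \<psi> (h y)"
        and g = "\<lambda>y. \<phi> y + c *\<^sub>R ?n y"] \<psi>h[OF s] c[OF s] by simp
    ultimately have "h' s *\<^sub>R frame_T \<psi> (h s) = frame_T \<phi> s + c *\<^sub>R d"
      by (rule vector_derivative_unique_at[symmetric])
    \<comment> \<open>Pairing the two expressions for \<open>(\<psi> \<circ> h)'\<close> with \<open>n'\<close> gives \<open>0 = - \<kappa> + c (\<kappa>\<^sup>2 + \<tau>\<^sup>2)\<close>.\<close>
    then have "(h' s *\<^sub>R frame_T \<psi> (h s)) \<bullet> d = (frame_T \<phi> s + c *\<^sub>R d) \<bullet> d" by simp
    then show "curvature \<phi> s = c * ((curvature \<phi> s)\<^sup>2 + (torsion_quotient \<phi> s)\<^sup>2)"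
      using Td d(2,3) by (simp add: inner_add_left)
  qed
qed

text \<open>Multiplying the relation by the fourth power of the curvature leaves an equation that, once squared,
  involves only functions that are analytic everywhere.\<close>
lemma curvature_relation_iff:
  assumes "curvature \<phi> s \<noteq> 0"
  shows "curvature \<phi> s = c * ((curvature \<phi> s)\<^sup>2 + (torsion_quotient \<phi> s)\<^sup>2) \<longleftrightarrow>
    (curvature \<phi> s) ^ 5 = c * (((curvature \<phi> s)\<^sup>2) ^ 3 + (triple \<phi> s)\<^sup>2)"
proof -
  let ?k = "curvature \<phi> s"
  have "?k ^ 4 * (?k\<^sup>2 + (torsion_quotient \<phi> s)\<^sup>2) = (?k\<^sup>2) ^ 3 + (triple \<phi> s)\<^sup>2"
    using assms by (simp add: torsion_quotient_triple field_simps flip: power_add power_mult)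
  then have "(?k\<^sup>2) ^ 3 + (triple \<phi> s)\<^sup>2 = ?k ^ 4 * (?k\<^sup>2 + (torsion_quotient \<phi> s)\<^sup>2)" by simp
  moreover have "?k ^ 5 = ?k ^ 4 * ?k" by (simp add: eval_nat_numeral)
  ultimately have "?k ^ 5 = c * ((?k\<^sup>2) ^ 3 + (triple \<phi> s)\<^sup>2) \<longleftrightarrow>
      ?k ^ 4 * ?k = ?k ^ 4 * (c * (?k\<^sup>2 + (torsion_quotient \<phi> s)\<^sup>2))"
    by (simp add: mult.left_commute)
  then show ?thesis using assms by simp
qed

text \<open>The relation expresses the square of the torsion as \<open>\<kappa> / c - \<kappa>\<^sup>2\<close>, which is continuous and vanishes
  with \<open>\<kappa>\<close>.\<close>
lemma torsion_at_curvature_zero: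
  assumes \<phi>: "space_curve I \<phi>" "s \<in> I" and s0: "curvature \<phi> s = 0"
    and "c \<noteq> 0"
    and rel: "\<And>y. y \<in> I \<Longrightarrow> curvature \<phi> y \<noteq> 0 \<Longrightarrow>
      curvature \<phi> y = c * ((curvature \<phi> y)\<^sup>2 + (torsion_quotient \<phi> y)\<^sup>2)"
  shows "(torsion_quotient \<phi> \<longlongrightarrow> 0) (at s)"
proof -
  have "(curvature \<phi> \<longlongrightarrow> 0) (at s)"
    using isCont_curvature[OF \<phi>] s0 by (simp add: isCont_def)
  then have "((\<lambda>y. sqrt (curvature \<phi> y / c - (curvature \<phi> y)\<^sup>2)) \<longlongrightarrow> sqrt (0 / c - 0\<^sup>2)) (at s)"
    by (intro tendsto_intros) (use \<open>c \<noteq> 0\<close> in auto)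
  moreover have "\<forall>\<^sub>F y in at s. y \<in> I"
    using space_curve_nhds[OF \<phi>] by (simp add: eventually_at_filter eventually_mono)
  then have "\<forall>\<^sub>F y in at s. sqrt (curvature \<phi> y / c - (curvature \<phi> y)\<^sup>2) = \<bar>torsion_quotient \<phi> y\<bar>"
    using curvature_nonzero_punctured[OF \<phi>]
  proof eventually_elim
    case (elim y)
    have "curvature \<phi> y / c = (curvature \<phi> y)\<^sup>2 + (torsion_quotient \<phi> y)\<^sup>2"
      using rel[OF elim] \<open>c \<noteq> 0\<close> by (simp add: divide_eq_eq mult.commute)
    then have "curvature \<phi> y / c - (curvature \<phi> y)\<^sup>2 = (torsion_quotient \<phi> y)\<^sup>2" by simp
    then show ?case by simp
  qed
  ultimately have "((\<lambda>y. \<bar>torsion_quotient \<phi> y\<bar>) \<longlongrightarrow> 0) (at s)"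
    by (simp add: tendsto_cong)
  then show ?thesis by (rule tendsto_rabs_zero_cancel)
qed

text \<open>The identity theorem applies to the squared relation, which has forgotten the sign of the constant.
  Curvature and \<open>\<kappa>\<^sup>2 + \<tau>\<^sup>2\<close> are nonnegative, so the square root can be taken with the absolute value.\<close>
lemma curvature_relation_global:
  assumes \<phi>: "space_curve I \<phi>" and U: "open U" "U \<subseteq> I" "a \<in> U"
    and nz: "\<And>s. s \<in> U \<Longrightarrow> curvature \<phi> s \<noteq> 0"
    and rel: "\<And>s. s \<in> U \<Longrightarrow> curvature \<phi> s = l * ((curvature \<phi> s)\<^sup>2 + (torsion_quotient \<phi> s)\<^sup>2)"
  shows "\<exists>c. c \<noteq> 0 \<and> (\<forall>s\<in>I. curvature \<phi> s = c * ((curvature \<phi> s)\<^sup>2 + (torsion \<phi> s)\<^sup>2))"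
proof -
  \<comment> \<open>The square of the polynomial form of the relation: only even powers of the curvature are left.\<close>
  define P where "P s = ((curvature \<phi> s)\<^sup>2) ^ 5 - l\<^sup>2 * (((curvature \<phi> s)\<^sup>2) ^ 3 + (triple \<phi> s)\<^sup>2)\<^sup>2" for s
  have "real_analytic_at P s" if "s \<in> I" for s
    unfolding P_def
    by (intro real_analytic_at_diff real_analytic_at_mult[OF real_analytic_at_const] real_analytic_at_add real_analytic_at_power[where f = "\<lambda>y. _ y + _ y"]
        real_analytic_at_power[OF real_analytic_at_curvature_sq[OF \<phi> that]] real_analytic_at_power[OF real_analytic_at_triple[OF \<phi> that]])
  moreover have "P s = 0" if "s \<in> U" for s
  proof -
    have "((curvature \<phi> s) ^ 5)\<^sup>2 = (l * (((curvature \<phi> s)\<^sup>2) ^ 3 + (triple \<phi> s)\<^sup>2))\<^sup>2"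
      using rel[OF that] curvature_relation_iff[OF nz[OF that]] by metis
    then show ?thesis by (simp add: P_def power_mult_distrib flip: power_mult)
  qed
  then have "\<forall>\<^sub>F s in nhds a. P s = 0"
    using eventually_nhds_in_open[OF U(1,3)] by (auto elim: eventually_mono)
  ultimately have P0: "P s = 0" if "s \<in> I" for s
    using \<phi> U(2,3) that by (intro real_analytic_at_identity_interval[of I P a s]) (auto simp: space_curve_def)
  have "l \<noteq> 0" using rel[OF U(3)] nz[OF U(3)] by auto
  have main: "curvature \<phi> s = \<bar>l\<bar> * ((curvature \<phi> s)\<^sup>2 + (torsion_quotient \<phi> s)\<^sup>2)"
    if "s \<in> I" "curvature \<phi> s \<noteq> 0" for s
  proof -
    have "((curvature \<phi> s) ^ 5)\<^sup>2 = (\<bar>l\<bar> * (((curvature \<phi> s)\<^sup>2) ^ 3 + (triple \<phi> s)\<^sup>2))\<^sup>2"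
      using P0[OF that(1)] by (simp add: P_def power_mult_distrib flip: power_mult)
    then have "(curvature \<phi> s) ^ 5 = \<bar>l\<bar> * (((curvature \<phi> s)\<^sup>2) ^ 3 + (triple \<phi> s)\<^sup>2)"
      by (rule power2_eq_imp_eq) (auto simp: curvature_def)
    then show ?thesis using curvature_relation_iff[OF that(2)] by blast
  qed
  have "curvature \<phi> s = \<bar>l\<bar> * ((curvature \<phi> s)\<^sup>2 + (torsion \<phi> s)\<^sup>2)" if "s \<in> I" for s
  proof (cases "curvature \<phi> s = 0")
    case True
    have "(torsion_quotient \<phi> \<longlongrightarrow> 0) (at s)"
      using torsion_at_curvature_zero[OF \<phi> that True _ main] \<open>l \<noteq> 0\<close> by simp
    then have "torsion \<phi> s = 0" using True by (simp add: torsion_def tendsto_Lim)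
    then show ?thesis using True by simp
  qed (use main that in \<open>simp add: torsion_def\<close>)
  then show ?thesis using \<open>l \<noteq> 0\<close> by (intro exI[of _ "\<bar>l\<bar>"]) simp
qed

text \<open>A correspondence of parameters might a priori send an interval into the zeros of the curvature of the
  second curve. Being continuous and injective it covers an interval, and the curvature does not vanish
  on an interval.\<close>
lemma curvature_not_zero_on_image:
  fixes h :: "real \<Rightarrow> real"
  assumes \<psi>: "space_curve J \<psi>" and ab: "a < b"
    and h: "continuous_on {a..b} h" "inj_on h {a..b}" "h ` {a..b} \<subseteq> J"
  shows "\<exists>s\<in>{a..b}. curvature \<psi> (h s) \<noteq> 0"
proof (rule ccontr)
  assume neg: "\<not> ?thesis"
  have "connected (h ` {a..b})" using h(1) by (intro connected_continuous_image) auto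
  then have int: "is_interval (h ` {a..b})" by (simp add: is_interval_connected_1)
  define p where "p = min (h a) (h b)"
  define q where "q = max (h a) (h b)"
  have pq: "p \<in> h ` {a..b}" "q \<in> h ` {a..b}" using ab by (auto simp: p_def q_def min_def max_def)
  have "h a \<noteq> h b" using inj_onD[OF h(2), of a b] ab by auto
  then have "p < q" by (auto simp: p_def q_def)
  have sub: "{p..q} \<subseteq> h ` {a..b}" using int pq unfolding is_interval_1 by auto
  define m where "m = (p + q) / 2"
  have m: "p < m" "m < q" using \<open>p < q\<close> by (auto simp: m_def)
  have "\<forall>\<^sub>F y in nhds m. y \<in> {p<..<q}" using m by (intro eventually_nhds_in_open) auto
  then have ev: "\<forall>\<^sub>F y in nhds m. (curvature \<psi> y)\<^sup>2 = 0"
  proof eventually_elim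
    case (elim y)
    then have "y \<in> h ` {a..b}" using sub by (meson atLeastAtMost_iff greaterThanLessThan_iff less_imp_le subsetD)
    then show ?case using neg by auto
  qed
  have "m \<in> J" using m sub h(3) by (meson atLeastAtMost_iff less_imp_le subsetD)
  then have "(curvature \<psi> y)\<^sup>2 = 0" if "y \<in> J" for y
    using real_analytic_at_identity_interval[of J "\<lambda>y. (curvature \<psi> y)\<^sup>2" m y] real_analytic_at_curvature_sq[OF \<psi>] \<psi> ev that
    by (auto simp: space_curve_def)
  then show False using \<psi> by (auto simp: space_curve_def)
qed

lemma isCont_neq_zero_nhds: 
  fixes f :: "real \<Rightarrow> real"
  shows "isCont f x \<Longrightarrow> f x \<noteq> 0 \<Longrightarrow> \<forall>\<^sub>F y in nhds x. f y \<noteq> 0"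
  using isCont_tendsto_nhds tendsto_imp_eventually_ne by blast

text \<open>Shrinking first around a point where the curvature of \<open>\<phi>\<close> is nonzero, and then inside that
  interval around one where the curvature of \<open>\<psi>\<close> is nonzero, gives an interval on which the lines are compared.\<close>
theorem mannheim_curve_imp_relation:
  assumes "mannheim_curve I \<phi>"
  shows "\<exists>c. c \<noteq> 0 \<and> (\<forall>s\<in>I. curvature \<phi> s = c * ((curvature \<phi> s)\<^sup>2 + (torsion \<phi> s)\<^sup>2))"
proof -
  from assms obtain J \<psi> h where \<phi>: "space_curve I \<phi>" and \<psi>: "space_curve J \<psi>"
    and bij: "bij_betw h I J" and hd: "h differentiable_on I"
    and lines: "\<forall>s\<in>I. curvature \<phi> s \<noteq> 0 \<longrightarrow> curvature \<psi> (h s) \<noteq> 0 \<longrightarrow>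
           principal_normal_line \<phi> s = binormal_line \<psi> (h s)"
    unfolding mannheim_curve_def mannheim_pair_def by metis
  have I: "open I" "is_interval I" using \<phi> by (auto simp: space_curve_def)
  have hJ: "h s \<in> J" if "s \<in> I" for s using bij that by (auto simp: bij_betw_def)
  have dh: "(h has_real_derivative deriv h s) (at s)" if "s \<in> I" for s
    using hd that I(1) by (metis DERIV_deriv_iff_real_differentiable at_within_open differentiable_on_def)
  obtain s1 where s1: "s1 \<in> I" "curvature \<phi> s1 \<noteq> 0" using \<phi> by (auto simp: space_curve_def)
  have "\<forall>\<^sub>F y in nhds s1. y \<in> I \<and> curvature \<phi> y \<noteq> 0"
    by (intro eventually_conj space_curve_nhds[OF \<phi> s1(1)] isCont_neq_zero_nhds isCont_curvature[OF \<phi> s1(1)] s1(2))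
  then obtain e where e: "e > 0" "\<And>y. \<bar>y - s1\<bar> < e \<Longrightarrow> y \<in> I \<and> curvature \<phi> y \<noteq> 0"
    unfolding eventually_nhds_metric dist_real_def by metis
  have near: "y \<in> I" "curvature \<phi> y \<noteq> 0" if "y \<in> {s1..s1 + e / 2}" for y
    using e(2)[of y] that e(1) by auto
  have "\<exists>s\<in>{s1..s1 + e / 2}. curvature \<psi> (h s) \<noteq> 0"
  proof (rule curvature_not_zero_on_image[OF \<psi>])
    show "continuous_on {s1..s1 + e / 2} h"
      using near dh by (intro continuous_at_imp_continuous_on) (blast intro: DERIV_isCont)
    show "inj_on h {s1..s1 + e / 2}" using bij near by (meson bij_betw_def inj_on_subset subsetI)
    show "h ` {s1..s1 + e / 2} \<subseteq> J" using near hJ by blast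
  qed (use e in simp)
  then obtain s2 where s2: "s2 \<in> I" "curvature \<phi> s2 \<noteq> 0" "curvature \<psi> (h s2) \<noteq> 0"
    using near by blast
  have "isCont (\<lambda>y. curvature \<psi> (h y)) s2"
    by (rule isCont_o2[OF DERIV_isCont[OF dh[OF s2(1)]] isCont_curvature[OF \<psi> hJ[OF s2(1)]]])
  then have "\<forall>\<^sub>F y in nhds s2. (y \<in> I \<and> curvature \<phi> y \<noteq> 0) \<and> curvature \<psi> (h y) \<noteq> 0"
    by (intro eventually_conj space_curve_nhds[OF \<phi> s2(1)] isCont_neq_zero_nhds isCont_curvature[OF \<phi> s2(1)] s2)
  then obtain d where d: "d > 0" "\<And>y. dist y s2 < d \<Longrightarrow> (y \<in> I \<and> curvature \<phi> y \<noteq> 0) \<and> curvature \<psi> (h y) \<noteq> 0"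
    unfolding eventually_nhds_metric by metis
  then have U: "\<And>y. y \<in> ball s2 d \<Longrightarrow> y \<in> I" "\<And>y. y \<in> ball s2 d \<Longrightarrow> curvature \<phi> y \<noteq> 0"
      "\<And>y. y \<in> ball s2 d \<Longrightarrow> curvature \<psi> (h y) \<noteq> 0"
    by (simp_all add: dist_commute)
  obtain l where "\<And>s. s \<in> ball s2 d \<Longrightarrow> curvature \<phi> s = l * ((curvature \<phi> s)\<^sup>2 + (torsion_quotient \<phi> s)\<^sup>2)"
  proof (rule mannheim_relation_on_interval[OF \<phi> \<psi>, of "ball s2 d" h "deriv h"])
    show "is_interval (ball s2 d)" by (simp add: is_interval_ball_real)
  qed (use U hJ dh lines in auto)
  then show ?thesis
    using d(1) U by (intro curvature_relation_global[OF \<phi>, of "ball s2 d" s2 l]) auto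
qed

section \<open>Analytic extension of the principal normal\<close>

lemma isCont_eq_at_limit:
  fixes f g :: "real \<Rightarrow> real"
  assumes "isCont f s" "isCont g s" "\<forall>\<^sub>F y in at s. f y = g y"
  shows "f s = g s"
proof -
  have "(f \<longlongrightarrow> f s) (at s)" "(g \<longlongrightarrow> g s) (at s)" using assms(1,2) by (simp_all add: isCont_def)
  then have "(g \<longlongrightarrow> f s) (at s)" using assms(3) by (simp add: tendsto_cong)
  with \<open>(g \<longlongrightarrow> g s) (at s)\<close> show ?thesis using tendsto_unique[of "at s"] by auto
qed

lemma eventually_at_in_curve:
  assumes "space_curve I \<phi>" "s \<in> I" shows "\<forall>\<^sub>F y in at s. y \<in> I \<and> curvature \<phi> y \<noteq> 0"
proof -
  have "\<forall>\<^sub>F y in at s. y \<in> I"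
    using space_curve_nhds[OF assms] by (simp add: eventually_at_filter eventually_mono)
  then show ?thesis using curvature_nonzero_punctured[OF assms] by (rule eventually_conj)
qed

text \<open>In general the curvature, being a norm, may have corners at its zeros (like \<open>\<bar>s\<bar>\<close> for a planar
  inflection). The relation forbids this: the torsion is a bounded quotient of analytic
  functions, so it extends analytically, and the right hand side of the relation extends the curvature.\<close>
lemma real_analytic_at_curvature_of_relation:
  assumes \<phi>: "space_curve I \<phi>" "s \<in> I" and "c \<noteq> 0"
    and rel: "\<And>y. y \<in> I \<Longrightarrow> curvature \<phi> y \<noteq> 0 \<Longrightarrow>
      curvature \<phi> y = c * ((curvature \<phi> y)\<^sup>2 + (torsion_quotient \<phi> y)\<^sup>2)"
  shows "real_analytic_at (curvature \<phi>) s"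
proof (cases "curvature \<phi> s = 0")
  case True
  have "(torsion_quotient \<phi> \<longlongrightarrow> 0) (at s)"
    by (rule torsion_at_curvature_zero[OF \<phi> True \<open>c \<noteq> 0\<close> rel])
  then have "\<forall>\<^sub>F y in at s. dist (torsion_quotient \<phi> y) 0 < 1" by (rule tendstoD) simp
  then have bd: "\<forall>\<^sub>F y in at s. \<bar>triple \<phi> y / (curvature \<phi> y)\<^sup>2\<bar> \<le> 1"
    by eventually_elim (simp add: torsion_quotient_triple)
  have "\<forall>\<^sub>F y in at s. (curvature \<phi> y)\<^sup>2 \<noteq> 0"
    using curvature_nonzero_punctured[OF \<phi>] by simp
  from real_analytic_at_removable_quotient[OF real_analytic_at_triple[OF \<phi>] real_analytic_at_curvature_sq[OF \<phi>] this bd]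
  obtain q where q: "real_analytic_at q s" "\<forall>\<^sub>F y in at s. q y = triple \<phi> y / (curvature \<phi> y)\<^sup>2" by blast
  define k where "k y = c * ((curvature \<phi> y)\<^sup>2 + (q y)\<^sup>2)" for y
  have k: "real_analytic_at k s" unfolding k_def by (intro real_analytic_at_mult[OF real_analytic_at_const] real_analytic_at_add real_analytic_at_curvature_sq[OF \<phi>] real_analytic_at_power[OF q(1)])
  have ev: "\<forall>\<^sub>F y in at s. k y = curvature \<phi> y"
    using q(2) eventually_at_in_curve[OF \<phi>]
    by eventually_elim (use rel in \<open>simp add: k_def torsion_quotient_triple\<close>)
  moreover have "k s = curvature \<phi> s"
    by (rule isCont_eq_at_limit[OF real_analytic_at_isCont[OF k] isCont_curvature[OF \<phi>] ev])
  ultimately have "\<forall>\<^sub>F y in nhds s. k y = curvature \<phi> y"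
    unfolding eventually_at_filter by (auto elim!: eventually_mono)
  with k show ?thesis by (rule real_analytic_at_cong)
qed (rule real_analytic_at_curvature[OF \<phi>])

text \<open>A limit, so that the unit normal is also defined at the zeros of the curvature, where \<open>\<phi>'' / \<kappa>\<close>
  is not.\<close>
definition normal_ext :: "(real \<Rightarrow> real^3) \<Rightarrow> real \<Rightarrow> real^3" where
  "normal_ext \<phi> s = Lim (at s) (principal_normal \<phi>)"

lemma normal_ext_eq:
  assumes "space_curve I \<phi>" "s \<in> I" "curvature \<phi> s \<noteq> 0"
  shows "normal_ext \<phi> s = principal_normal \<phi> s"
proof -
  obtain d where "(principal_normal \<phi> has_vector_derivative d) (at s)"
    using principal_normal_has_derivative[OF assms] by blast
  then have "isCont (principal_normal \<phi>) s" by (rule has_vector_derivative_continuous)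
  then show ?thesis unfolding normal_ext_def isCont_def by (simp add: tendsto_Lim)
qed

text \<open>Each coordinate of \<open>\<phi>'' / \<kappa>\<close> is a quotient of analytic functions bounded by \<open>1\<close>, so it has a
  removable singularity at every zero of \<open>\<kappa>\<close>. The identities pass to the zeros by continuity.\<close>
lemma normal_ext:
  assumes \<phi>: "space_curve I \<phi>" and k: "\<And>s. s \<in> I \<Longrightarrow> real_analytic_at (curvature \<phi>) s" and s: "s \<in> I"
  shows "vec_analytic_at (normal_ext \<phi>) s" "normal_ext \<phi> s \<bullet> normal_ext \<phi> s = 1"
    "frame_T \<phi> s \<bullet> normal_ext \<phi> s = 0" "frame_N \<phi> s = curvature \<phi> s *\<^sub>R normal_ext \<phi> s"
proof -
  have pn: "\<forall>\<^sub>F y in at s. normal_ext \<phi> y = principal_normal \<phi> y"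
    using eventually_at_in_curve[OF \<phi> s] by eventually_elim (auto intro: normal_ext_eq[OF \<phi>])
  have "\<forall>i. \<exists>q. real_analytic_at q s \<and> (\<forall>\<^sub>F y in at s. q y = frame_N \<phi> y $ i / curvature \<phi> y)"
  proof
    fix i
    show "\<exists>q. real_analytic_at q s \<and> (\<forall>\<^sub>F y in at s. q y = frame_N \<phi> y $ i / curvature \<phi> y)"
    proof (rule real_analytic_at_removable_quotient[where M = 1])
      show "real_analytic_at (\<lambda>y. frame_N \<phi> y $ i) s" using frame_analytic(3)[OF \<phi> s] by (simp add: vec_analytic_at_def)
      show "\<forall>\<^sub>F y in at s. \<bar>frame_N \<phi> y $ i / curvature \<phi> y\<bar> \<le> 1"
        using curvature_nonzero_punctured[OF \<phi> s]
        by eventually_elim (simp add: curvature_def component_le_norm_cart divide_le_eq_1)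
    qed (use k[OF s] curvature_nonzero_punctured[OF \<phi> s] in auto)
  qed
  then obtain q where q: "\<And>i. real_analytic_at (q i) s" "\<And>i. \<forall>\<^sub>F y in at s. q i y = frame_N \<phi> y $ i / curvature \<phi> y"
    by metis
  define Q where "Q y = (\<chi> i. q i y)" for y
  have Q: "vec_analytic_at Q s" using q(1) by (simp add: vec_analytic_at_def Q_def)
  have "\<forall>\<^sub>F y in at s. \<forall>i. q i y = frame_N \<phi> y $ i / curvature \<phi> y"
    by (rule eventually_all_finite) (rule q(2))
  then have evQ: "\<forall>\<^sub>F y in at s. Q y = principal_normal \<phi> y"
    by eventually_elim (simp add: Q_def principal_normal_def vec_eq_iff)
  have "isCont Q s" using vec_analytic_at_has_vector_derivative(1)[OF Q] by (rule has_vector_derivative_continuous)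
  then have "(Q \<longlongrightarrow> Q s) (at s)" by (simp add: isCont_def)
  then have "(principal_normal \<phi> \<longlongrightarrow> Q s) (at s)" using evQ by (rule Lim_transform_eventually)
  then have "normal_ext \<phi> s = Q s" by (simp add: normal_ext_def tendsto_Lim)
  moreover have "\<forall>\<^sub>F y in at s. Q y = normal_ext \<phi> y" using evQ pn by eventually_elim simp
  ultimately have "\<forall>\<^sub>F y in nhds s. Q y = normal_ext \<phi> y"
    unfolding eventually_at_filter by (auto elim!: eventually_mono)
  with Q show an: "vec_analytic_at (normal_ext \<phi>) s" by (rule vec_analytic_at_cong)
  show "normal_ext \<phi> s \<bullet> normal_ext \<phi> s = 1"
  proof (rule isCont_eq_at_limit[where f = "\<lambda>y. normal_ext \<phi> y \<bullet> normal_ext \<phi> y" and s = s and g = "\<lambda>y. 1"])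
    show "\<forall>\<^sub>F y in at s. normal_ext \<phi> y \<bullet> normal_ext \<phi> y = 1"
      using pn curvature_nonzero_punctured[OF \<phi> s] by eventually_elim (simp add: principal_normal_simps)
  qed (auto intro!: real_analytic_at_isCont vec_analytic_at_inner an)
  show "frame_T \<phi> s \<bullet> normal_ext \<phi> s = 0"
  proof (rule isCont_eq_at_limit[where f = "\<lambda>y. frame_T \<phi> y \<bullet> normal_ext \<phi> y" and s = s and g = "\<lambda>y. 0"])
    show "\<forall>\<^sub>F y in at s. frame_T \<phi> y \<bullet> normal_ext \<phi> y = 0"
      using pn eventually_at_in_curve[OF \<phi> s]
      by eventually_elim (simp add: principal_normal_def frame_T_N_orthogonal[OF \<phi>])
  qed (auto intro!: real_analytic_at_isCont vec_analytic_at_inner an frame_analytic[OF \<phi> s])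
  show "frame_N \<phi> s = curvature \<phi> s *\<^sub>R normal_ext \<phi> s"
  proof (cases "curvature \<phi> s = 0")
    case False
    then show ?thesis using normal_ext_eq[OF \<phi> s False] principal_normal_simps(1) by simp
  qed (simp add: curvature_def)
qed

section \<open>The Mannheim partner\<close>

lemma has_vector_derivative_cross:
  assumes "(u has_vector_derivative u') (at s)" "(w has_vector_derivative w') (at s)"
  shows "((\<lambda>y. cross3 (u y) (w y)) has_vector_derivative (cross3 (u s) w' + cross3 u' (w s))) (at s)"
  using bounded_bilinear.has_vector_derivative[OF _ assms, of cross3] bilinear_cross
  by (simp add: bilinear_conv_bounded_bilinear)

text \<open>Applied with \<open>v\<close> the speed of an analytic curve: \<open>h\<close> is its arc length, and analyticity of the
  inverse \<open>g\<close> is what keeps the reparametrized curve analytic.\<close>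
lemma arc_length_reparametrization:
  assumes I: "open I" "is_interval I" and v: "\<And>s. s \<in> I \<Longrightarrow> real_analytic_at v s" "\<And>s. s \<in> I \<Longrightarrow> v s > 0"
  obtains h g :: "real \<Rightarrow> real" where "open (h ` I)" "is_interval (h ` I)" "inj_on h I"
    "\<And>s. s \<in> I \<Longrightarrow> (h has_real_derivative v s) (at s)"
    "\<And>s. s \<in> I \<Longrightarrow> g (h s) = s" "\<And>s. s \<in> I \<Longrightarrow> real_analytic_at g (h s)"
    "\<And>s. s \<in> I \<Longrightarrow> (g has_real_derivative (1 / v s)) (at (h s))"
proof -
  have "continuous_on I v" using v(1) real_analytic_at_isCont by (intro continuous_at_imp_continuous_on) blast
  then obtain h where h: "\<And>s. s \<in> I \<Longrightarrow> (h has_real_derivative v s) (at s)"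
    using primitive_on_open_interval[OF I] by blast
  have mono: "h a < h b" if "a \<in> I" "b \<in> I" "a < b" for a b
  proof (rule DERIV_pos_imp_increasing[OF that(3)])
    fix x assume "a \<le> x" "x \<le> b"
    then have "x \<in> I" using I(2) that unfolding is_interval_1 by blast
    then show "\<exists>y. (h has_real_derivative y) (at x) \<and> 0 < y" using h v(2) by blast
  qed
  have inj: "inj_on h I" by (rule inj_onI) (metis mono linorder_neqE_linordered_idom less_irrefl)
  have cont: "continuous_on I h" using h by (intro continuous_at_imp_continuous_on) (blast intro: DERIV_isCont)
  have op: "open (h ` I)" by (rule invariance_of_domain[OF cont I(1) inj])
  have "connected (h ` I)" using cont I(2) is_interval_connected by (blast intro: connected_continuous_image)
  then have int: "is_interval (h ` I)" by (simp add: is_interval_connected_1)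
  define g where "g = the_inv_into I h"
  have gh: "g (h s) = s" if "s \<in> I" for s unfolding g_def by (rule the_inv_into_f_f[OF inj that])
  have hg: "h (g y) = y" if "y \<in> h ` I" for y using gh that by auto
  have gcont: "continuous_on (h ` I) g"
    using continuous_on_inverse_open[OF I(1) cont _ gh] by simp
  have isCont_g: "isCont g y" if "y \<in> h ` I" for y using gcont op that continuous_on_eq_continuous_at by blast
  have ev: "\<forall>\<^sub>F y in nhds (h s). y \<in> h ` I" if "s \<in> I" for s
    using op that by (intro eventually_nhds_in_open) auto
  have anh: "real_analytic_at h s" if "s \<in> I" for s
    using v(1)[OF that] 
    by (rule real_analytic_at_antiderivative) (use eventually_nhds_in_open[OF I(1) that] h in \<open>auto elim: eventually_mono\<close>)
  have ang: "real_analytic_at g (h s)" if s: "s \<in> I" for s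
  proof (rule real_analytic_at_inverse)
    show "real_analytic_at h (g (h s))" using anh gh s by simp
    show "(h has_real_derivative v s) (at (g (h s)))" using h gh s by simp
    show "v s \<noteq> 0" using v(2)[OF s] by simp
    show "isCont g (h s)" using isCont_g s by simp
    show "\<forall>\<^sub>F y in nhds (h s). h (g y) = y" using ev[OF s] by eventually_elim (rule hg)
  qed
  have dg: "(g has_real_derivative (1 / v s)) (at (h s))" if s: "s \<in> I" for s
  proof -
    have g': "(g has_real_derivative deriv g (h s)) (at (h s))"
      using eventually_nhds_x_imp_x[OF real_analytic_at_deriv(1)[OF ang[OF s]]] .
    have "((\<lambda>y. g (h y)) has_real_derivative deriv g (h s) * v s) (at s)"
      using DERIV_chain2[OF g' h[OF s]] .
    moreover have "\<forall>\<^sub>F y in nhds s. g (h y) = y"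
      using eventually_nhds_in_open[OF I(1) s] by eventually_elim (rule gh)
    ultimately have "((\<lambda>y. y) has_real_derivative deriv g (h s) * v s) (at s)"
      using DERIV_cong_ev[OF refl _ refl, of "\<lambda>y. g (h y)" "\<lambda>y. y" s] by blast
    then have "deriv g (h s) * v s = 1" using DERIV_unique DERIV_ident by blast
    then have "deriv g (h s) = 1 / v s" using v(2)[OF s] by (simp add: field_simps)
    with g' show ?thesis by simp
  qed
  show thesis by (rule that[of h g]) (use op int inj h gh ang dg in auto)
qed

lemma parallel_lines_eq:
  fixes p n :: "real^3"
  assumes "a \<noteq> 0" "b \<noteq> 0"
  shows "range (\<lambda>r. p + r *\<^sub>R (a *\<^sub>R n)) = range (\<lambda>r. (p + c *\<^sub>R n) + r *\<^sub>R (b *\<^sub>R n))"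
proof (intro equalityI subsetI; elim rangeE)
  fix x r assume "x = p + r *\<^sub>R (a *\<^sub>R n)"
  then have "x = (p + c *\<^sub>R n) + ((r * a - c) / b) *\<^sub>R (b *\<^sub>R n)"
    using assms by (simp add: scaleR_left_diff_distrib)
  then show "x \<in> range (\<lambda>r. (p + c *\<^sub>R n) + r *\<^sub>R (b *\<^sub>R n))" by (rule image_eqI) simp
next
  fix x r assume "x = (p + c *\<^sub>R n) + r *\<^sub>R (b *\<^sub>R n)"
  then have "x = p + ((c + r * b) / a) *\<^sub>R (a *\<^sub>R n)"
    using assms by (simp add: scaleR_left_distrib)
  then show "x \<in> range (\<lambda>r. p + r *\<^sub>R (a *\<^sub>R n))" by (rule image_eqI) simp
qed

text \<open>The partner is \<open>\<phi> + c n\<close> in its own arc length \<open>h\<close>. It is a space curve with nonvanishing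
  curvature somewhere because otherwise \<open>v\<close>, and with it the curvature of \<open>\<phi>\<close>, would be constant.\<close>
theorem relation_imp_mannheim_curve:
  assumes \<phi>: "space_curve I \<phi>" and nd: "nondegenerate_curve I \<phi>" and c: "c \<noteq> 0"
    and rel0: "\<And>s. s \<in> I \<Longrightarrow> curvature \<phi> s = c * ((curvature \<phi> s)\<^sup>2 + (torsion \<phi> s)\<^sup>2)"
  shows "mannheim_curve I \<phi>"
proof -
  have I: "open I" "is_interval I" using \<phi> by (auto simp: space_curve_def)
  define k where "k = curvature \<phi>"
  define T where "T = frame_T \<phi>"
  define n where "n = normal_ext \<phi>"
  define d where "d s = vector_derivative n (at s)" for s
  define b where "b s = cross3 (T s) (n s)" for s
  define \<tau> where "\<tau> s = T s \<bullet> cross3 (n s) (d s)" for s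
  have relq: "k s = c * ((k s)\<^sup>2 + (torsion_quotient \<phi> s)\<^sup>2)" if "s \<in> I" "k s \<noteq> 0" for s
    using rel0[OF that(1)] that(2) by (simp add: k_def torsion_def)
  have ank: "real_analytic_at k s" if "s \<in> I" for s
    unfolding k_def by (rule real_analytic_at_curvature_of_relation[OF \<phi> that c relq[unfolded k_def]])
  have T: "vec_analytic_at T s" "(T has_vector_derivative (k s *\<^sub>R n s)) (at s)" "T s \<bullet> T s = 1" "T s \<bullet> n s = 0" "n s \<bullet> n s = 1"
      "frame_N \<phi> s = k s *\<^sub>R n s" "vec_analytic_at n s" if s: "s \<in> I" for s
    using frame_analytic(2,6)[OF \<phi> s] frame_T_unit[OF \<phi> s] normal_ext[OF \<phi> _ s] ank 
    unfolding T_def n_def k_def by simp_all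
  have dn: "(n has_vector_derivative d s) (at s)" and an_d: "vec_analytic_at d s" if "s \<in> I" for s
    using vec_analytic_at_has_vector_derivative[OF T(7)[OF that]] unfolding d_def by simp_all
  have evI: "\<forall>\<^sub>F y in nhds s. y \<in> I" if "s \<in> I" for s by (rule eventually_nhds_in_open[OF I(1) that])
  have d: "d s = (- k s) *\<^sub>R T s + \<tau> s *\<^sub>R b s" if s: "s \<in> I" for s
    unfolding \<tau>_def b_def T_def
  proof (rule unit_normal_derivative[OF \<phi> s dn[OF s]])
    show "\<forall>\<^sub>F y in nhds s. n y \<bullet> n y = 1" using evI[OF s] by eventually_elim (rule T)
    show "\<forall>\<^sub>F y in nhds s. frame_T \<phi> y \<bullet> n y = 0" using evI[OF s] by eventually_elim (rule T(4)[unfolded T_def])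
    show "frame_N \<phi> s = k s *\<^sub>R n s" by (rule T(6)[OF s])
  qed
  have \<tau>q: "torsion_quotient \<phi> s = \<tau> s" if s: "s \<in> I" and nz: "k s \<noteq> 0" for s
    unfolding \<tau>_def T_def
  proof (rule torsion_quotient_unit_normal[OF \<phi> s dn[OF s]])
    show "(k has_real_derivative deriv k s) (at s)"
      using eventually_nhds_x_imp_x[OF real_analytic_at_deriv(1)[OF ank[OF s]]] .
    show "k s = curvature \<phi> s" "curvature \<phi> s \<noteq> 0" using nz by (simp_all add: k_def)
    show "\<forall>\<^sub>F y in nhds s. frame_N \<phi> y = k y *\<^sub>R n y" using evI[OF s] by eventually_elim (rule T)
  qed
  have an\<tau>: "real_analytic_at \<tau> s" if s: "s \<in> I" for s
    unfolding \<tau>_def by (intro vec_analytic_at_inner vec_analytic_at_cross T[OF s] an_d[OF s])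
  have rel: "k s = c * ((k s)\<^sup>2 + (\<tau> s)\<^sup>2)" if s: "s \<in> I" for s
  proof (rule isCont_eq_at_limit[where f = k and g = "\<lambda>s. c * ((k s)\<^sup>2 + (\<tau> s)\<^sup>2)"])
    show "isCont k s" by (rule real_analytic_at_isCont[OF ank[OF s]])
    show "isCont (\<lambda>s. c * ((k s)\<^sup>2 + (\<tau> s)\<^sup>2)) s"
      by (intro real_analytic_at_isCont real_analytic_at_mult[OF real_analytic_at_const] real_analytic_at_add real_analytic_at_power[OF ank[OF s]] real_analytic_at_power[OF an\<tau>[OF s]])
    show "\<forall>\<^sub>F y in at s. k y = c * ((k y)\<^sup>2 + (\<tau> y)\<^sup>2)"
      using eventually_at_in_curve[OF \<phi> s]
      by eventually_elim (use relq \<tau>q in \<open>simp add: k_def\<close>)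
  qed
  have rel': "k s - c * (k s)\<^sup>2 = c * (\<tau> s)\<^sup>2" if "s \<in> I" for s
    using rel[OF that] by (metis add_diff_cancel_left' distrib_left)
  have "c > 0"
  proof -
    obtain a where a: "a \<in> I" "curvature \<phi> a \<noteq> 0" using \<phi> by (auto simp: space_curve_def)
    then have "k a > 0" by (simp add: k_def curvature_def)
    then show ?thesis using rel[OF a(1)] by (metis sum_power2_ge_zero zero_less_mult_pos2 mult_nonneg_nonpos2 not_less mult.commute)
  qed
  \<comment> \<open>By the relation \<open>\<kappa> (1 - c \<kappa>) = c \<tau>\<^sup>2\<close>, so \<open>1 - c \<kappa>\<close>, the squared speed of the partner, is positive.\<close>
  have pos: "1 - c * k s > 0" if s: "s \<in> I" for s
  proof (cases "k s = 0")
    case False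
    then have "k s > 0" by (simp add: k_def curvature_def)
    have "\<tau> s \<noteq> 0" using nd s False \<tau>q[OF s False] by (auto simp: nondegenerate_curve_def k_def torsion_def)
    have "k s * (1 - c * k s) = k s - c * (k s)\<^sup>2" by (simp add: power2_eq_square algebra_simps)
    also have "\<dots> = c * (\<tau> s)\<^sup>2" by (rule rel'[OF s])
    also have "\<dots> > 0" using \<open>c > 0\<close> \<open>\<tau> s \<noteq> 0\<close> by simp
    finally show ?thesis using \<open>k s > 0\<close> by (simp add: zero_less_mult_iff)
  qed simp
  define v where "v s = sqrt (1 - c * k s)" for s
  define w where "w s = c * \<tau> s / v s" for s
  have vpos: "v s > 0" if "s \<in> I" for s using pos[OF that] by (simp add: v_def)
  have v2: "(v s)\<^sup>2 = 1 - c * k s" if "s \<in> I" for s using pos[OF that] by (simp add: v_def)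
  have vw: "v s * w s = c * \<tau> s" if "s \<in> I" for s using vpos[OF that] by (simp add: w_def)
  \<comment> \<open>The normal components of \<open>(v t)'\<close> and \<open>(w b)'\<close> are \<open>v \<kappa>\<close> and \<open>- w \<tau>\<close>; their cancellation makes
    the principal normal of the partner orthogonal to \<open>n\<close>.\<close>
  have w\<tau>: "w s * \<tau> s = v s * k s" if s: "s \<in> I" for s
  proof -
    have "v s * (w s * \<tau> s) = c * (\<tau> s)\<^sup>2" using vw[OF s] by (simp add: power2_eq_square flip: mult.assoc)
    also have "\<dots> = k s - c * (k s)\<^sup>2" by (rule rel'[OF s, symmetric])
    also have "\<dots> = (v s)\<^sup>2 * k s" unfolding v2[OF s] by (simp add: power2_eq_square algebra_simps)
    also have "\<dots> = v s * (v s * k s)" by (simp add: power2_eq_square)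
    finally show ?thesis using vpos[OF s] by simp
  qed
  have unit: "(v s)\<^sup>2 + (w s)\<^sup>2 = 1" if s: "s \<in> I" for s
  proof -
    have "v s * (w s)\<^sup>2 = c * (w s * \<tau> s)" using vw[OF s] by (simp add: power2_eq_square mult.left_commute flip: mult.assoc)
    also have "\<dots> = v s * (c * k s)" using w\<tau>[OF s] by simp
    finally have "(w s)\<^sup>2 = c * k s" using vpos[OF s] by simp
    then show ?thesis using v2[OF s] by simp
  qed
  have anv: "real_analytic_at v s" if s: "s \<in> I" for s
    unfolding v_def by (intro real_analytic_at_sqrt real_analytic_at_diff real_analytic_at_const real_analytic_at_mult ank[OF s] pos[OF s])
  have anw: "real_analytic_at w s" if s: "s \<in> I" for s
    unfolding w_def using vpos[OF s] by (intro real_analytic_at_divide real_analytic_at_mult real_analytic_at_const an\<tau>[OF s] anv[OF s]) simp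
  obtain h g where J: "open (h ` I)" "is_interval (h ` I)" and inj: "inj_on h I"
    and dh: "\<And>s. s \<in> I \<Longrightarrow> (h has_real_derivative v s) (at s)"
    and gh: "\<And>s. s \<in> I \<Longrightarrow> g (h s) = s" and ang: "\<And>s. s \<in> I \<Longrightarrow> real_analytic_at g (h s)"
    and dg: "\<And>s. s \<in> I \<Longrightarrow> (g has_real_derivative (1 / v s)) (at (h s))"
    using arc_length_reparametrization[OF I anv vpos] by metis
  define p where "p s = \<phi> s + c *\<^sub>R n s" for s
  define \<psi> where "\<psi> = (\<lambda>y. p (g y))"
  \<comment> \<open>\<open>E\<close> is the unit tangent of the partner as a function of the parameter of \<open>\<phi>\<close>, and \<open>E'\<close> its derivative.\<close>
  define E where "E s = v s *\<^sub>R T s + w s *\<^sub>R b s" for s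
  define E' where "E' s = deriv v s *\<^sub>R T s + deriv w s *\<^sub>R b s" for s
  have chain: "((\<lambda>y. u (g y)) has_vector_derivative (1 / v s) *\<^sub>R u') (at (h s))"
    if s: "s \<in> I" and u: "(u has_vector_derivative u') (at s)" for u u' s
    using vector_diff_chain_at[of g "1 / v s" "h s" u u'] dg[OF s] u gh[OF s]
    by (simp add: o_def has_real_derivative_iff_has_vector_derivative)
  have bT: "T s \<bullet> b s = 0" "b s \<bullet> T s = 0" "n s \<bullet> b s = 0" for s
    by (simp_all add: b_def dot_cross_self)
  have bb: "b s \<bullet> b s = 1" if s: "s \<in> I" for s
    using norm_cross_dot[of "T s" "n s"] T[OF s] by (simp add: b_def power2_norm_eq_inner power_mult_distrib)
  have Tb: "cross3 (T s) (b s) = - n s" if s: "s \<in> I" for s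
    using Lagrange[of "T s" "T s" "n s"] T(3,4)[OF s] by (simp add: b_def)
  have EE: "E s \<bullet> E s = 1" if s: "s \<in> I" for s
    using unit[OF s] bb[OF s] T(3)[OF s] by (simp add: E_def inner_add_left inner_add_right bT power2_eq_square)
  have dp: "(p has_vector_derivative v s *\<^sub>R E s) (at s)" if s: "s \<in> I" for s
  proof -
    have "(p has_vector_derivative (T s + c *\<^sub>R d s)) (at s)"
      unfolding p_def T_def by (auto intro!: derivative_eq_intros frame_analytic[OF \<phi> s] dn[OF s])
    moreover have "T s + c *\<^sub>R d s = (v s)\<^sup>2 *\<^sub>R T s + (v s * w s) *\<^sub>R b s"
      unfolding d[OF s] v2[OF s] vw[OF s] by (simp add: algebra_simps)
    ultimately show ?thesis by (simp add: E_def scaleR_add_right power2_eq_square)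
  qed
  have T\<psi>: "frame_T \<psi> (h s) = E s" if s: "s \<in> I" for s
    using vector_derivative_at[OF chain[OF s dp[OF s]]] vpos[OF s] by (simp add: frame_T_def \<psi>_def)
  have db: "(b has_vector_derivative - (\<tau> s) *\<^sub>R n s) (at s)" if s: "s \<in> I" for s
  proof -
    have "(b has_vector_derivative (cross3 (T s) (d s) + cross3 (k s *\<^sub>R n s) (n s))) (at s)"
      unfolding b_def by (rule has_vector_derivative_cross[OF T(2)[OF s] dn[OF s]])
    moreover have "cross3 (T s) (d s) + cross3 (k s *\<^sub>R n s) (n s) = - (\<tau> s) *\<^sub>R n s"
      unfolding d[OF s] by (simp add: cross_add_right cross_mult_left cross_mult_right Tb[OF s] Cross3.right_diff_distrib)
    ultimately show ?thesis by simp
  qed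
  have dE: "(E has_vector_derivative E' s) (at s)" if s: "s \<in> I" for s
  proof -
    have "(E has_vector_derivative (v s *\<^sub>R (k s *\<^sub>R n s) + deriv v s *\<^sub>R T s + (w s *\<^sub>R (- (\<tau> s) *\<^sub>R n s) + deriv w s *\<^sub>R b s))) (at s)"
      unfolding E_def
      by (intro has_vector_derivative_add has_vector_derivative_scaleR T(2) db s
          eventually_nhds_x_imp_x[OF real_analytic_at_deriv(1)[OF anv[OF s]]] eventually_nhds_x_imp_x[OF real_analytic_at_deriv(1)[OF anw[OF s]]])
    moreover have "v s *\<^sub>R (k s *\<^sub>R n s) + w s *\<^sub>R (- (\<tau> s) *\<^sub>R n s) = 0"
      using w\<tau>[OF s] by simp
    then have "v s *\<^sub>R (k s *\<^sub>R n s) + deriv v s *\<^sub>R T s + (w s *\<^sub>R (- (\<tau> s) *\<^sub>R n s) + deriv w s *\<^sub>R b s) = E' s"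
      unfolding E'_def by (simp add: algebra_simps)
    ultimately show ?thesis by simp
  qed
  have N\<psi>: "frame_N \<psi> (h s) = (1 / v s) *\<^sub>R E' s" if s: "s \<in> I" for s
  proof -
    have "\<forall>\<^sub>F y in nhds (h s). y \<in> h ` I" using J(1) s by (intro eventually_nhds_in_open) auto
    then have "\<forall>\<^sub>F y in nhds (h s). E (g y) = frame_T \<psi> y"
      by eventually_elim (auto simp: T\<psi> gh)
    then have "(frame_T \<psi> has_vector_derivative (1 / v s) *\<^sub>R E' s) (at (h s))"
      using chain[OF s dE[OF s]] has_vector_derivative_cong_ev[where S = UNIV and x = "h s" and f = "\<lambda>y. E (g y)"
        and g = "frame_T \<psi>"] T\<psi>[OF s] gh[OF s] by simp
    then show ?thesis unfolding frame_N_def by (rule vector_derivative_at)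
  qed
  have B\<psi>: "\<exists>r. frame_B \<psi> (h s) = r *\<^sub>R n s" if s: "s \<in> I" for s
  proof -
    have "cross3 (b s) (T s) = n s" using cross_skew[of "b s" "T s"] Tb[OF s] by simp
    then have "frame_B \<psi> (h s) = ((1 / v s) * (w s * deriv v s - v s * deriv w s)) *\<^sub>R n s"
      unfolding frame_B_def T\<psi>[OF s] N\<psi>[OF s] E_def E'_def
      by (simp add: cross_add_left cross_add_right cross_mult_left cross_mult_right Tb[OF s] algebra_simps)
    then show ?thesis by blast
  qed
  have \<psi>: "space_curve (h ` I) \<psi>"
    unfolding space_curve_def
  proof (intro conjI ballI)
    show "open (h ` I)" "is_interval (h ` I)" by (fact J)+
    show "real_analytic_on \<psi> (h ` I)"
      unfolding real_analytic_on_iff_vec_analytic_at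
    proof (rule ballI, elim imageE, hypsubst)
      fix s assume s: "s \<in> I"
      have "vec_analytic_at p (g (h s))"
        unfolding gh[OF s] p_def by (intro vec_analytic_at_add vec_analytic_at_scaleR real_analytic_at_const T(7)[OF s] frame_analytic(1)[OF \<phi> s])
      then show "vec_analytic_at \<psi> (h s)" unfolding \<psi>_def using ang[OF s] by (rule vec_analytic_at_compose[rotated])
    qed
    show "norm (frame_T \<psi> y) = 1" if "y \<in> h ` I" for y
      using that EE T\<psi> by (auto simp: norm_eq_1)
    show "\<exists>y\<in>h ` I. curvature \<psi> y \<noteq> 0"
    proof (rule ccontr)
      assume "\<not> ?thesis"
      then have "E' s = 0" if "s \<in> I" for s
        using N\<psi>[OF that] vpos[OF that] that by (auto simp: curvature_def)
      then have "E' s \<bullet> T s = 0" if "s \<in> I" for s using that by simp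
      then have "deriv v s = 0" if "s \<in> I" for s
        using T(3)[OF that] that by (force simp: E'_def inner_add_left bT)
      then have "(v has_real_derivative 0) (at s within I)" if "s \<in> I" for s
        using eventually_nhds_x_imp_x[OF real_analytic_at_deriv(1)[OF anv[OF that]]] that
        by (simp add: has_field_derivative_at_within)
      then obtain a where a: "\<And>s. s \<in> I \<Longrightarrow> v s = a"
        using has_field_derivative_zero_constant[of I v] I(2) is_interval_convex by blast
      have "k s = (1 - a\<^sup>2) / c" if "s \<in> I" for s
        using v2[OF that] a[OF that] c by (simp add: field_simps)
      then have "curvature \<phi> constant_on I" unfolding constant_on_def k_def by blast
      with nd show False by (simp add: nondegenerate_curve_def)
    qed
  qed
  have "principal_normal_line \<phi> s = binormal_line \<psi> (h s)"
    if s: "s \<in> I" and nz: "curvature \<phi> s \<noteq> 0" "curvature \<psi> (h s) \<noteq> 0" for s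
  proof -
    obtain r where r: "frame_B \<psi> (h s) = r *\<^sub>R n s" using B\<psi>[OF s] by blast
    have "frame_B \<psi> (h s) \<noteq> 0" using frame_B_norm[OF \<psi>, of "h s"] s nz(2) by auto
    then have "r \<noteq> 0" using r by auto
    moreover have "\<psi> (h s) = \<phi> s + c *\<^sub>R n s" by (simp add: \<psi>_def p_def gh[OF s])
    ultimately show ?thesis
      unfolding principal_normal_line_def binormal_line_def r T(6)[OF s]
      using nz(1) by (simp add: parallel_lines_eq k_def del: scaleR_scaleR)
  qed
  moreover have "h differentiable_on I"
    unfolding differentiable_on_def
    using dh real_differentiable_def differentiable_at_withinI by blast
  ultimately have "mannheim_pair I \<phi> (h ` I) \<psi>"
    unfolding mannheim_pair_def using \<phi> \<psi> inj by (blast intro: inj_on_imp_bij_betw)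
  then show ?thesis unfolding mannheim_curve_def by blast
qed

theorem theorem3p2:
  fixes I :: "real set" and \<phi> :: "real \<Rightarrow> real^3"
  assumes "space_curve I \<phi>"
  shows "(mannheim_curve I \<phi> \<longrightarrow>
            (\<exists>c. c \<noteq> 0 \<and> (\<forall>s\<in>I. curvature \<phi> s = c * ((curvature \<phi> s)\<^sup>2 + (torsion \<phi> s)\<^sup>2))))
       \<and> (nondegenerate_curve I \<phi> \<longrightarrow>
            (\<exists>c. c \<noteq> 0 \<and> (\<forall>s\<in>I. curvature \<phi> s = c * ((curvature \<phi> s)\<^sup>2 + (torsion \<phi> s)\<^sup>2))) \<longrightarrow>
            mannheim_curve I \<phi>)"
  using mannheim_curve_imp_relation relation_imp_mannheim_curve[OF assms] by blast

end
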